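(* Let $H$ and $H'$ be connected ordered graphs with at least one edge each. Then $r_<^m(H,H')=1$ and there is an ordered pseudoforest in $R_<(H,H')$ if and only if either one of $H,H'$ is $K_2$ and the other is a connected ordered proper pseudoforest, or both $H$ and $H'$ are monotone paths on three vertices (monotone $P_3$).
   Context: An ordered graph is a finite simple graph together with a linear order of its vertex set. An (ordered) subgraph inherits the vertex order; a copy of an ordered graph $H$ in $F$ is a subgraph of $F$ isomorphic to $H$ via an order-preserving bijection. $R_<(H,H')$ is the set of ordered graphs $F$ such that every red/blue coloring of the edges of $F$ contains a red copy of $H$ or a blue copy of $H'$. The density of a graph $G$ is $m(G)=\max\{|E(G')|/|V(G')| : G'\subseteq G\}$, and $r_<^m(H,H')=\inf\{m(F): F\in R_<(H,H')\}$. A pseudoforest is a graph $G$ with $m(G)\le 1$ (each component contains at most one cycle); a proper pseudoforest is a pseudoforest containing at least one cycle. A monotone $P_3$ is an ordered path $u_1u_2u_3$ with $u_1<u_2<u_3$. *)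

theory Defs
  imports Complex_Main
begin

text \<open>The linear order of the vertex set is the one induced by the vertex type, so subgraphs
  inherit it automatically. Every finite linearly ordered vertex set occurs in this way.\<close>

record 'a ograph =
  verts :: "'a set"
  edges :: "'a set set"

definition ordered_graph :: "'a::linorder ograph \<Rightarrow> bool" where
  "ordered_graph G \<longleftrightarrow> finite (verts G) \<and>
     (\<forall>e\<in>edges G. \<exists>u\<in>verts G. \<exists>v\<in>verts G. u \<noteq> v \<and> e = {u, v})"

definition subgraph :: "'a::linorder ograph \<Rightarrow> 'a ograph \<Rightarrow> bool" where
  "subgraph G' G \<longleftrightarrow> ordered_graph G' \<and> verts G' \<subseteq> verts G \<and> edges G' \<subseteq> edges G"

definition connected_graph :: "'a::linorder ograph \<Rightarrow> bool" where
  "connected_graph G \<longleftrightarrow> verts G \<noteq> {} \<and>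
     (\<forall>u\<in>verts G. \<forall>v\<in>verts G. (u, v) \<in> {(x, y). {x, y} \<in> edges G}\<^sup>*)"

definition ordered_iso :: "'a::linorder ograph \<Rightarrow> 'b::linorder ograph \<Rightarrow> bool" where
  "ordered_iso G H \<longleftrightarrow> (\<exists>f. bij_betw f (verts G) (verts H) \<and> strict_mono_on (verts G) f \<and>
     (\<forall>u\<in>verts G. \<forall>v\<in>verts G. {u, v} \<in> edges G \<longleftrightarrow> {f u, f v} \<in> edges H))"

definition copy_of :: "'b::linorder ograph \<Rightarrow> 'a::linorder ograph \<Rightarrow> 'a ograph \<Rightarrow> bool" where
  "copy_of H F C \<longleftrightarrow> subgraph C F \<and> ordered_iso C H"

datatype colour = Red | Blue

text \<open>A colouring is a function on all vertex sets, but only its values on the edges matter.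
  The host graphs are taken on natural numbers: every finite ordered graph is isomorphic to such a
  graph, and all notions below are invariant under order-preserving isomorphism.\<close>

definition ramsey_graphs :: "'a::linorder ograph \<Rightarrow> 'b::linorder ograph \<Rightarrow> nat ograph set" where
  "ramsey_graphs H H' = {F. ordered_graph F \<and> (\<forall>c :: nat set \<Rightarrow> colour.
     (\<exists>C. copy_of H F C \<and> (\<forall>e\<in>edges C. c e = Red)) \<or>
     (\<exists>C. copy_of H' F C \<and> (\<forall>e\<in>edges C. c e = Blue)))}"

text \<open>The subgraph without vertices contributes \<open>0 / 0 = 0\<close>, which does not affect the maximum
  for graphs with at least one vertex and makes the graph without vertices have density 0.\<close>

definition density :: "'a::linorder ograph \<Rightarrow> real" where
  "density G = Max {real (card (edges G')) / real (card (verts G')) | G'. subgraph G' G}"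

definition ramsey_density :: "'a::linorder ograph \<Rightarrow> 'b::linorder ograph \<Rightarrow> real" where
  "ramsey_density H H' = Inf (density ` ramsey_graphs H H')"

definition pseudoforest :: "'a::linorder ograph \<Rightarrow> bool" where
  "pseudoforest G \<longleftrightarrow> ordered_graph G \<and> density G \<le> 1"

definition contains_cycle :: "'a::linorder ograph \<Rightarrow> bool" where
  "contains_cycle G \<longleftrightarrow> (\<exists>xs. length xs \<ge> 3 \<and> distinct xs \<and> set xs \<subseteq> verts G \<and>
     (\<forall>i<length xs. {xs ! i, xs ! (Suc i mod length xs)} \<in> edges G))"

definition proper_pseudoforest :: "'a::linorder ograph \<Rightarrow> bool" where
  "proper_pseudoforest G \<longleftrightarrow> pseudoforest G \<and> contains_cycle G"

definition is_K2 :: "'a::linorder ograph \<Rightarrow> bool" where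
  "is_K2 G \<longleftrightarrow> (\<exists>u v. u \<noteq> v \<and> G = \<lparr>verts = {u, v}, edges = {{u, v}}\<rparr>)"

definition monotone_P3 :: "'a::linorder ograph \<Rightarrow> bool" where
  "monotone_P3 G \<longleftrightarrow> (\<exists>u1 u2 u3. u1 < u2 \<and> u2 < u3 \<and>
     G = \<lparr>verts = {u1, u2, u3}, edges = {{u1, u2}, {u2, u3}}\<rparr>)"

end

theory Submission
  imports Defs
begin

text \<open>A pair \<open>(H, H')\<close> satisfies the left-hand side iff some Ramsey graph is a pseudoforest and none
  is a forest. If \<open>H = K\<^sub>2\<close>, the Ramsey graphs are exactly the graphs containing \<open>H'\<close>. Otherwise both
  graphs contain a path on three vertices whose central vertex is leftmost, rightmost or second.
  Assign the edges of a pseudoforest to distinct endpoints. Colourings read off this assignment avoid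
  a red path of the first kind and a blue one of the second, and also a red monotone path and any
  connected blue graph with paths of both the first and the second kind. So, up to order reversal,
  no path of the second kind occurs. If one graph contains no monotone path either, it is a star with
  leftmost center, and a large tree in which each vertex has at most one left neighbour is a Ramsey
  forest. If both contain a monotone path, then colouring edges by a proper 2-colouring of the lower
  endpoints, repaired near each odd cycle, avoids a red monotone path and a given larger blue graph.\<close>

section \<open>Sparse graphs\<close>

text \<open>Once some Ramsey graph is a pseudoforest, the infimum is at most 1, and it equals 1
  exactly when no Ramsey graph has density below 1, that is, when no Ramsey graph is a forest.
  Everything thereby reduces to counting edges on vertex sets. The obstacle is the odd cycle. In a
  forest, colouring edges by a proper 2-colouring of their lower endpoints destroys the monotone
  paths of both colours. A triangle with two pendant edges shows that a pseudoforest need not admit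
  this. The repair therefore tolerates blue monotone paths and controls only how they extend. A
  connected graph without left stars that properly extends a monotone path on three vertices
  contains a fork (two right neighbours at the middle), a hook (a second right neighbour at the
  start) or a monotone path on four vertices. Against the hook, every edge entering an exceptional
  edge from the left has to be exceptional too; against the four-vertex path, exceptional edges must
  never be consecutive. No single repair rule does both, which is why there are two.\<close>

definition spanned :: "'a ograph \<Rightarrow> 'a set \<Rightarrow> 'a set set" where
  "spanned G W = {e \<in> edges G. e \<subseteq> W}"

definition sparse :: "'a ograph \<Rightarrow> bool" where
  "sparse G \<longleftrightarrow> (\<forall>W \<subseteq> verts G. card (spanned G W) \<le> card W)"

text \<open>For ordered graphs this characterises forests: the section on cycles proves it
  equivalent to the absence of a cycle. The empty set is excluded because the strict inequality
  fails there.\<close>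

definition strictly_sparse :: "'a ograph \<Rightarrow> bool" where
  "strictly_sparse G \<longleftrightarrow> (\<forall>W \<subseteq> verts G. W \<noteq> {} \<longrightarrow> card (spanned G W) < card W)"

lemma ordered_graphD:
  assumes "ordered_graph G" "{u, v} \<in> edges G"
  shows "u \<in> verts G" "v \<in> verts G" "u \<noteq> v"
proof -
  obtain x y where "x \<in> verts G" "y \<in> verts G" "x \<noteq> y" "{u, v} = {x, y}"
    using assms unfolding ordered_graph_def by blast
  then show "u \<in> verts G" "v \<in> verts G" "u \<noteq> v" by (auto simp: doubleton_eq_iff)
qed

lemma ordered_graph_edgeE:
  assumes "ordered_graph G" "e \<in> edges G"
  obtains u v where "e = {u, v}" "u < v" "u \<in> verts G" "v \<in> verts G"
proof -
  obtain u v where "u \<in> verts G" "v \<in> verts G" "u \<noteq> v" "e = {u, v}"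
    using assms unfolding ordered_graph_def by blast
  then show thesis using that[of u v] that[of v u] by (cases u v rule: linorder_cases) auto
qed

lemma ordered_graph_edgeD:
  assumes "ordered_graph G" "e \<in> edges G"
  shows "\<exists>u v. e = {u, v} \<and> u < v \<and> u \<in> verts G \<and> v \<in> verts G"
  using ordered_graph_edgeE[OF assms] by metis

lemma ordered_graphI:
  assumes "finite (verts G)"
    and "\<And>e. e \<in> edges G \<Longrightarrow> \<exists>u v. e = {u, v} \<and> u \<noteq> v \<and> u \<in> verts G \<and> v \<in> verts G"
  shows "ordered_graph G"
  unfolding ordered_graph_def using assms by meson

lemma edges_subset_Pow: "ordered_graph G \<Longrightarrow> edges G \<subseteq> Pow (verts G)"
  by (auto elim!: ordered_graph_edgeE)

lemma finite_verts: "ordered_graph G \<Longrightarrow> finite (verts G)"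
  unfolding ordered_graph_def by blast

lemma finite_edges: "ordered_graph G \<Longrightarrow> finite (edges G)"
  by (rule finite_subset[OF edges_subset_Pow]) (simp_all add: finite_verts)

lemma finite_spanned: "ordered_graph G \<Longrightarrow> finite (spanned G W)"
  unfolding spanned_def by (simp add: finite_edges)

definition induced :: "'a ograph \<Rightarrow> 'a set \<Rightarrow> 'a ograph" where
  "induced G W = \<lparr>verts = W, edges = spanned G W\<rparr>"

lemma induced_simps [simp]: "verts (induced G W) = W" "edges (induced G W) = spanned G W"
  by (simp_all add: induced_def)

lemma subgraph_induced:
  assumes "ordered_graph G" "W \<subseteq> verts G"
  shows "subgraph (induced G W) G"
proof -
  have "finite W" using assms finite_verts finite_subset by blast
  moreover have "\<exists>u v. e = {u, v} \<and> u \<noteq> v \<and> u \<in> W \<and> v \<in> W" if e: "e \<in> spanned G W" for e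
  proof -
    obtain u v where "e = {u, v}" "u < v"
      using e ordered_graph_edgeD[OF assms(1)] unfolding spanned_def by blast
    then show ?thesis using e by (intro exI[of _ u] exI[of _ v]) (auto simp: spanned_def)
  qed
  ultimately have "ordered_graph (induced G W)" by (intro ordered_graphI) simp_all
  then show ?thesis using assms by (auto simp: subgraph_def spanned_def)
qed

lemma ordered_graph_induced:
  "ordered_graph G \<Longrightarrow> W \<subseteq> verts G \<Longrightarrow> ordered_graph (induced G W)"
  by (rule subgraph_induced[unfolded subgraph_def, THEN conjunct1])

lemma spanned_induced [simp]: "U \<subseteq> W \<Longrightarrow> spanned (induced G W) U = spanned G U"
  by (auto simp: spanned_def)

lemma sparse_induced: "sparse G \<Longrightarrow> W \<subseteq> verts G \<Longrightarrow> sparse (induced G W)"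
  unfolding sparse_def induced_simps by (simp add: subset_trans)

definition density_set :: "'a::linorder ograph \<Rightarrow> real set" where
  "density_set G = (\<lambda>G'. real (card (edges G')) / real (card (verts G'))) ` {G'. subgraph G' G}"

lemma density_eq_Max: "density G = Max (density_set G)"
  by (simp add: density_def density_set_def setcompr_eq_image)

lemma finite_density_set:
  assumes "ordered_graph G"
  shows "finite (density_set G)"
proof -
  have "{G'. subgraph G' G} \<subseteq> (\<lambda>(V, E). \<lparr>verts = V, edges = E\<rparr>) ` (Pow (verts G) \<times> Pow (edges G))"
  proof
    fix G' assume "G' \<in> {G'. subgraph G' G}"
    then have "verts G' \<subseteq> verts G" "edges G' \<subseteq> edges G" by (auto simp: subgraph_def)
    then show "G' \<in> (\<lambda>(V, E). \<lparr>verts = V, edges = E\<rparr>) ` (Pow (verts G) \<times> Pow (edges G))"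
      by (intro image_eqI[of _ _ "(verts G', edges G')"]) auto
  qed
  moreover have "finite (Pow (verts G) \<times> Pow (edges G))"
    using assms finite_verts finite_edges by auto
  ultimately have "finite {G'. subgraph G' G}" by (meson finite_imageI finite_subset)
  then show ?thesis by (simp add: density_set_def)
qed

lemma empty_in_density_set: "0 \<in> density_set G"
proof -
  have "subgraph \<lparr>verts = {}, edges = {}\<rparr> G" by (auto simp: subgraph_def ordered_graph_def)
  then show ?thesis unfolding density_set_def by (intro image_eqI) auto
qed

lemma density_set_nonempty: "density_set G \<noteq> {}"
  using empty_in_density_set by blast

lemma induced_in_density_set:
  assumes "ordered_graph G" "W \<subseteq> verts G"
  shows "real (card (spanned G W)) / real (card W) \<in> density_set G"
  unfolding density_set_def
  using subgraph_induced[OF assms] by (intro image_eqI[of _ _ "induced G W"]) auto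

lemma density_nonneg: "ordered_graph G \<Longrightarrow> 0 \<le> density G"
  unfolding density_eq_Max by (rule Max_ge[OF finite_density_set empty_in_density_set])

lemma subgraph_edges_spanned:
  assumes "subgraph G' G"
  shows "edges G' \<subseteq> spanned G (verts G')" "verts G' \<subseteq> verts G" "finite (verts G')"
  using assms edges_subset_Pow[of G'] finite_verts by (auto simp: subgraph_def spanned_def)

text \<open>On a fixed vertex set the quotient is largest for the induced subgraph, so only the sets
  \<open>spanned G W\<close> matter. For empty \<open>W\<close> the quotient carries no information,
  but no edge is spanned.\<close>

lemma density_le_1_iff:
  assumes "ordered_graph G"
  shows "density G \<le> 1 \<longleftrightarrow> sparse G"
proof -
  have "density G \<le> 1 \<longleftrightarrow> (\<forall>x \<in> density_set G. x \<le> 1)"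
    unfolding density_eq_Max by (rule Max_le_iff[OF finite_density_set[OF assms] density_set_nonempty])
  also have "\<dots> \<longleftrightarrow> sparse G"
  proof
    assume *: "\<forall>x \<in> density_set G. x \<le> 1"
    show "sparse G" unfolding sparse_def
    proof (intro allI impI)
      fix W assume W: "W \<subseteq> verts G"
      then have "real (card (spanned G W)) / real (card W) \<le> 1"
        using * induced_in_density_set[OF assms W] by blast
      moreover have "finite W" using W assms finite_verts finite_subset by blast
      moreover have "spanned G {} = {}" using assms by (auto simp: spanned_def ordered_graph_def)
      ultimately show "card (spanned G W) \<le> card W"
        by (cases "W = {}") (auto simp: divide_le_eq card_gt_0_iff)
    qed
  next
    assume sp: "sparse G"
    show "\<forall>x \<in> density_set G. x \<le> 1"
    proof
      fix x assume "x \<in> density_set G"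
      then obtain G' where G': "subgraph G' G" and x: "x = real (card (edges G')) / real (card (verts G'))"
        unfolding density_set_def by blast
      have "card (edges G') \<le> card (verts G')"
        using subgraph_edges_spanned[OF G'] finite_spanned[OF assms] sp
        unfolding sparse_def by (meson card_mono le_trans)
      then show "x \<le> 1" unfolding x by (simp add: divide_le_eq)
    qed
  qed
  finally show ?thesis .
qed

lemma density_less_1_iff:
  assumes "ordered_graph G"
  shows "density G < 1 \<longleftrightarrow> strictly_sparse G"
proof -
  have "density G < 1 \<longleftrightarrow> (\<forall>x \<in> density_set G. x < 1)"
    unfolding density_eq_Max by (rule Max_less_iff[OF finite_density_set[OF assms] density_set_nonempty])
  also have "\<dots> \<longleftrightarrow> strictly_sparse G"
  proof
    assume *: "\<forall>x \<in> density_set G. x < 1"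
    show "strictly_sparse G" unfolding strictly_sparse_def
    proof (intro allI impI)
      fix W assume W: "W \<subseteq> verts G" and ne: "W \<noteq> {}"
      then have "real (card (spanned G W)) / real (card W) < 1"
        using * induced_in_density_set[OF assms W] by blast
      moreover have "finite W" using W assms finite_verts finite_subset by blast
      ultimately show "card (spanned G W) < card W"
        using ne by (auto simp: divide_less_eq card_gt_0_iff)
    qed
  next
    assume sp: "strictly_sparse G"
    show "\<forall>x \<in> density_set G. x < 1"
    proof
      fix x assume "x \<in> density_set G"
      then obtain G' where G': "subgraph G' G" and x: "x = real (card (edges G')) / real (card (verts G'))"
        unfolding density_set_def by blast
      \<comment> \<open>Strict sparsity says nothing about the empty vertex set; there the quotient
        is 0 by the convention for division by zero.\<close>
      have "card (edges G') < card (verts G') \<or> verts G' = {}"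
        using subgraph_edges_spanned[OF G'] finite_spanned[OF assms] sp
        unfolding strictly_sparse_def by (meson card_mono le_less_trans)
      then show "x < 1" unfolding x by (auto simp: divide_less_eq)
    qed
  qed
  finally show ?thesis .
qed

section \<open>Embeddings and colour classes\<close>

definition embeds :: "'a::linorder ograph \<Rightarrow> 'b::linorder ograph \<Rightarrow> bool" where
  "embeds H G \<longleftrightarrow> (\<exists>\<phi>. strict_mono_on (verts H) \<phi> \<and> \<phi> ` verts H \<subseteq> verts G \<and>
     (\<forall>u v. {u, v} \<in> edges H \<longrightarrow> {\<phi> u, \<phi> v} \<in> edges G))"

definition colour_class :: "'a ograph \<Rightarrow> ('a set \<Rightarrow> colour) \<Rightarrow> colour \<Rightarrow> 'a ograph" where
  "colour_class F c k = \<lparr>verts = verts F, edges = {e \<in> edges F. c e = k}\<rparr>"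

lemma colour_class_simps [simp]:
  "verts (colour_class F c k) = verts F"
  "edges (colour_class F c k) = {e \<in> edges F. c e = k}"
  by (simp_all add: colour_class_def)

definition relabel :: "('a \<Rightarrow> 'b) \<Rightarrow> 'a ograph \<Rightarrow> 'b ograph" where
  "relabel f G = \<lparr>verts = f ` verts G, edges = (`) f ` edges G\<rparr>"

lemma relabel_simps [simp]:
  "verts (relabel f G) = f ` verts G" "edges (relabel f G) = (`) f ` edges G"
  by (simp_all add: relabel_def)

lemma ordered_graph_relabel:
  assumes "ordered_graph G" "inj_on f (verts G)"
  shows "ordered_graph (relabel f G)"
proof (rule ordered_graphI)
  show "finite (verts (relabel f G))" using assms finite_verts by auto
  fix e assume "e \<in> edges (relabel f G)"
  then obtain d where d: "d \<in> edges G" "e = f ` d" unfolding relabel_simps by (elim imageE) 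
  obtain u v where "d = {u, v}" "u < v" "u \<in> verts G" "v \<in> verts G"
    using ordered_graph_edgeE[OF assms(1) d(1)] .
  moreover then have "f u \<noteq> f v" using assms(2) by (auto dest: inj_onD)
  ultimately show "\<exists>u v. e = {u, v} \<and> u \<noteq> v \<and> u \<in> verts (relabel f G) \<and> v \<in> verts (relabel f G)"
    using d by (intro exI[of _ "f u"] exI[of _ "f v"]) simp
qed

lemma relabel_edge_iff:
  assumes "ordered_graph G" "inj_on f (verts G)" "u \<in> verts G" "v \<in> verts G"
  shows "{f u, f v} \<in> edges (relabel f G) \<longleftrightarrow> {u, v} \<in> edges G"
proof
  assume "{f u, f v} \<in> edges (relabel f G)"
  then obtain d where d: "d \<in> edges G" "f ` {u, v} = f ` d" by auto
  moreover have "d \<subseteq> verts G" "{u, v} \<subseteq> verts G"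
    using d(1) edges_subset_Pow[OF assms(1)] assms by auto
  ultimately have "{u, v} = d" using inj_on_image_eq_iff[OF assms(2), of "{u, v}" d] by blast
  then show "{u, v} \<in> edges G" using d by simp
next
  assume "{u, v} \<in> edges G"
  then have "f ` {u, v} \<in> (`) f ` edges G" by (rule imageI)
  then show "{f u, f v} \<in> edges (relabel f G)" by simp
qed

lemma relabel_inv:
  assumes "ordered_graph G" "inj_on f (verts G)"
  shows "relabel (inv_into (verts G) f) (relabel f G) = G"
proof -
  have e: "inv_into (verts G) f ` (f ` e) = e" if "e \<in> edges G" for e
    using edges_subset_Pow[OF assms(1)] that by (intro inv_into_image_cancel[OF assms(2)]) auto
  have "(\<lambda>e. inv_into (verts G) f ` (f ` e)) ` edges G = edges G"
    using image_cong[OF refl e, of "edges G"] by simp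
  moreover have "inv_into (verts G) f ` f ` verts G = verts G"
    by (rule inv_into_image_cancel[OF assms(2) order_refl])
  ultimately show ?thesis unfolding relabel_def by (simp add: image_image)
qed

text \<open>Embeddings preserve edges without reflecting them. Nothing is lost: the image with only
  the image edges kept is a subgraph isomorphic to \<open>H\<close>.\<close>

lemma mono_copy_iff_embeds:
  fixes H :: "'a::linorder ograph" and F :: "'b::linorder ograph"
  assumes H: "ordered_graph H"
  shows "(\<exists>C. copy_of H F C \<and> (\<forall>e\<in>edges C. c e = k)) \<longleftrightarrow> embeds H (colour_class F c k)"
proof
  assume "\<exists>C. copy_of H F C \<and> (\<forall>e\<in>edges C. c e = k)"
  then obtain C f where C: "subgraph C F" "\<forall>e\<in>edges C. c e = k"
    and f: "bij_betw f (verts C) (verts H)" "strict_mono_on (verts C) f"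
    and e: "\<forall>u\<in>verts C. \<forall>v\<in>verts C. {u, v} \<in> edges C \<longleftrightarrow> {f u, f v} \<in> edges H"
    unfolding copy_of_def ordered_iso_def by blast
  define p where "p = inv_into (verts C) f"
  have p: "p x \<in> verts C" "f (p x) = x" if "x \<in> verts H" for x
    using f(1) that unfolding p_def bij_betw_def
    by (auto intro: inv_into_into f_inv_into_f)
  have "strict_mono_on (verts H) p"
  proof (rule strict_mono_onI)
    fix r s assume "r \<in> verts H" "s \<in> verts H" "r < s"
    then show "p r < p s"
      using p f(2) by (metis linorder_less_linear order_less_imp_not_less strict_mono_onD)
  qed
  moreover have "{p u, p v} \<in> edges (colour_class F c k)" if uv: "{u, v} \<in> edges H" for u v
  proof -
    have "u \<in> verts H" "v \<in> verts H" using ordered_graphD[OF H uv] by auto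
    then have "{p u, p v} \<in> edges C" using e p uv by metis
    then show ?thesis using C by (auto simp: subgraph_def)
  qed
  moreover have "p ` verts H \<subseteq> verts F" using p C by (auto simp: subgraph_def)
  ultimately show "embeds H (colour_class F c k)" unfolding embeds_def by auto
next
  assume "embeds H (colour_class F c k)"
  then obtain p where p: "strict_mono_on (verts H) p" "p ` verts H \<subseteq> verts F"
    and e: "\<And>u v. {u, v} \<in> edges H \<Longrightarrow> {p u, p v} \<in> edges F \<and> c {p u, p v} = k"
    unfolding embeds_def by auto
  have inj: "inj_on p (verts H)" using p(1) strict_mono_on_imp_inj_on by blast
  define C where "C = relabel p H"
  define f where "f = inv_into (verts H) p"
  have CE: "d \<in> edges F \<and> c d = k" if d: "d \<in> edges C" for d
  proof -
    obtain b where "b \<in> edges H" "d = p ` b"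
      using d unfolding C_def by auto
    moreover then obtain u v where "b = {u, v}" using H ordered_graph_edgeD by metis
    ultimately show ?thesis using e[of u v] by simp
  qed
  have "subgraph C F" unfolding subgraph_def
    using CE p(2) ordered_graph_relabel[OF H inj] by (auto simp: C_def)
  moreover have "ordered_iso C H" unfolding ordered_iso_def
  proof (intro exI[of _ f] conjI ballI)
    show "bij_betw f (verts C) (verts H)" unfolding f_def C_def
      using inj by (auto intro: bij_betw_inv_into bij_betw_imageI)
    have fp: "f (p x) = x" if "x \<in> verts H" for x using that inj by (simp add: f_def)
    show "strict_mono_on (verts C) f"
    proof (rule strict_mono_onI)
      fix r s assume "r \<in> verts C" "s \<in> verts C" "r < s"
      then show "f r < f s"
        using p(1) fp unfolding C_def
        by (auto simp: strict_mono_on_less)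
    qed
    show "({u, v} \<in> edges C) = ({f u, f v} \<in> edges H)" if "u \<in> verts C" "v \<in> verts C" for u v
    proof -
      obtain a b where "a \<in> verts H" "b \<in> verts H" "u = p a" "v = p b"
        using \<open>u \<in> verts C\<close> \<open>v \<in> verts C\<close> by (auto simp: C_def)
      then show ?thesis using relabel_edge_iff[OF H inj, of a b] fp by (simp add: C_def)
    qed
  qed
  ultimately show "\<exists>C. copy_of H F C \<and> (\<forall>e\<in>edges C. c e = k)"
    using CE unfolding copy_of_def by blast
qed

lemma ramsey_graphs_iff:
  assumes "ordered_graph H" "ordered_graph H'"
  shows "F \<in> ramsey_graphs H H' \<longleftrightarrow> ordered_graph F \<and>
    (\<forall>c. embeds H (colour_class F c Red) \<or> embeds H' (colour_class F c Blue))"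
  unfolding ramsey_graphs_def mono_copy_iff_embeds[OF assms(1)] mono_copy_iff_embeds[OF assms(2)]
  by simp

lemma ramsey_graphs_swap:
  assumes "ordered_graph H" "ordered_graph H'"
  shows "ramsey_graphs H H' = ramsey_graphs H' H"
proof -
  \<comment> \<open>One inclusion, by exchanging the colours, is stated over fresh vertex types,
    because its two uses interchange the types of the two graphs.\<close>
  have *: "F \<in> ramsey_graphs G' G" if F: "F \<in> ramsey_graphs G G'" and "ordered_graph G" "ordered_graph G'"
    for F and G :: "'c::linorder ograph" and G' :: "'d::linorder ograph"
  proof -
    have "embeds G' (colour_class F c Red) \<or> embeds G (colour_class F c Blue)" for c
    proof -
      define d where "d e = (if c e = Red then Blue else Red)" for e
      have "d e = Red \<longleftrightarrow> c e = Blue" "d e = Blue \<longleftrightarrow> c e = Red" for e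
        by (cases "c e"; simp add: d_def)+
      then have "colour_class F d Red = colour_class F c Blue" "colour_class F d Blue = colour_class F c Red"
        by (simp_all add: colour_class_def)
      moreover have "embeds G (colour_class F d Red) \<or> embeds G' (colour_class F d Blue)"
        using F ramsey_graphs_iff[OF that(2,3)] by blast
      ultimately show ?thesis by auto
    qed
    then show ?thesis
      using F ramsey_graphs_iff[OF that(2,3)] ramsey_graphs_iff[OF that(3,2)] by blast
  qed
  show ?thesis using *[OF _ assms] *[OF _ assms(2,1)] by (intro equalityI subsetI)
qed

lemma embeds_card_spanned:
  assumes "ordered_graph G" "ordered_graph H"
    and p: "strict_mono_on (verts H) p" "\<And>u v. {u, v} \<in> edges H \<Longrightarrow> {p u, p v} \<in> edges G"
    and W: "W \<subseteq> verts H"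
  shows "card (spanned H W) \<le> card (spanned G (p ` W))" "card (p ` W) = card W"
proof -
  have inj: "inj_on p (verts H)" using p(1) strict_mono_on_imp_inj_on by blast
  show "card (p ` W) = card W" using inj W by (meson card_image inj_on_subset)
  have "inj_on ((`) p) (spanned H W)"
  proof (rule inj_onI)
    fix x y assume "x \<in> spanned H W" "y \<in> spanned H W" "p ` x = p ` y"
    moreover then have "x \<subseteq> verts H" "y \<subseteq> verts H" using W by (auto simp: spanned_def)
    ultimately show "x = y" using inj_on_image_eq_iff[OF inj] by simp
  qed
  moreover have "(`) p ` spanned H W \<subseteq> spanned G (p ` W)"
  proof
    fix d assume "d \<in> (`) p ` spanned H W"
    then obtain e where e: "e \<in> edges H" "e \<subseteq> W" "d = p ` e" by (auto simp: spanned_def)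
    then obtain u v where "e = {u, v}" using assms(2) ordered_graph_edgeD by metis
    then show "d \<in> spanned G (p ` W)" using e p(2)[of u v] by (auto simp: spanned_def)
  qed
  ultimately show "card (spanned H W) \<le> card (spanned G (p ` W))"
    using finite_spanned[OF assms(1)] by (rule card_inj_on_le)
qed

lemma sparse_embeds:
  assumes "ordered_graph G" "ordered_graph H" "embeds H G" "sparse G"
  shows "sparse H"
proof -
  obtain p where p: "strict_mono_on (verts H) p" "p ` verts H \<subseteq> verts G"
    "\<And>u v. {u, v} \<in> edges H \<Longrightarrow> {p u, p v} \<in> edges G"
    using assms(3) unfolding embeds_def by blast
  show ?thesis unfolding sparse_def
  proof (intro allI impI)
    fix W assume W: "W \<subseteq> verts H"
    then have "card (spanned G (p ` W)) \<le> card (p ` W)"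
      using assms(4) p(2) unfolding sparse_def by (meson image_mono order_trans)
    then show "card (spanned H W) \<le> card W"
      using embeds_card_spanned[OF assms(1,2) p(1,3) W] by simp
  qed
qed

lemma strictly_sparse_embeds:
  assumes "ordered_graph G" "ordered_graph H" "embeds H G" "strictly_sparse G"
  shows "strictly_sparse H"
proof -
  obtain p where p: "strict_mono_on (verts H) p" "p ` verts H \<subseteq> verts G"
    "\<And>u v. {u, v} \<in> edges H \<Longrightarrow> {p u, p v} \<in> edges G"
    using assms(3) unfolding embeds_def by blast
  show ?thesis unfolding strictly_sparse_def
  proof (intro allI impI)
    fix W assume W: "W \<subseteq> verts H" "W \<noteq> {}"
    then have "p ` W \<subseteq> verts G" "p ` W \<noteq> {}" using p(2) by auto
    then have "card (spanned G (p ` W)) < card (p ` W)"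
      using assms(4) unfolding strictly_sparse_def by blast
    then show "card (spanned H W) < card W"
      using embeds_card_spanned[OF assms(1,2) p(1,3) W(1)] by simp
  qed
qed

section \<open>Orientations\<close>

text \<open>A special case of Hall's theorem. The capacity set \<open>B\<close> of still unused vertices makes the
  induction on the number of edges work: if neither endpoint of an edge can be chosen, then there
  are tight sets around both endpoints, and their union spans too many edges.\<close>

lemma orientation_capacity:
  assumes "finite V" "finite E" "\<And>e. e \<in> E \<Longrightarrow> \<exists>u v. u \<in> V \<and> v \<in> V \<and> u \<noteq> v \<and> e = {u, v}"
    and "\<And>W. W \<subseteq> V \<Longrightarrow> card {e \<in> E. e \<subseteq> W} \<le> card (W \<inter> B)"
  shows "\<exists>g. inj_on g E \<and> g ` E \<subseteq> B \<and> (\<forall>e\<in>E. g e \<in> e)"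
  using assms(2-)
proof (induction "card E" arbitrary: E B)
  case 0
  then show ?case by simp
next
  case (Suc n)
  then obtain e where e: "e \<in> E" by fastforce
  obtain u v where uv: "u \<in> V" "v \<in> V" "u \<noteq> v" "e = {u, v}" using Suc.prems(2)[OF e] by blast
  define E' where "E' = E - {e}"
  have fE: "finite E'" "finite E" using Suc.prems(1) by (auto simp: E'_def)
  \<comment> \<open>A good \<open>x\<close> can be given to \<open>e\<close> and struck from the
    capacity set while the counting hypothesis survives for the remaining edges.\<close>
  define good where
    "good x \<longleftrightarrow> x \<in> B \<and> (\<forall>W \<subseteq> V. card {d \<in> E'. d \<subseteq> W} \<le> card (W \<inter> (B - {x})))" for x
  \<comment> \<open>If \<open>x\<close> has no capacity, \<open>{x}\<close> is tight with capacity
    0. Otherwise a set violating the condition after the removal of \<open>x\<close> must contain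
    \<open>x\<close>, and its full capacity is already used up by edges other than \<open>e\<close>;
    so it cannot contain \<open>y\<close> as well.\<close>
  have tight: "\<exists>W \<subseteq> V. x \<in> W \<and> y \<notin> W \<and> card (W \<inter> B) \<le> card {d \<in> E. d \<subseteq> W}"
    if xy: "e = {x, y}" "x \<noteq> y" "x \<in> V" and ng: "\<not> good x" for x y
  proof (cases "x \<in> B")
    case False
    then show ?thesis using xy by (intro exI[of _ "{x}"]) auto
  next
    case True
    then obtain W where W: "W \<subseteq> V" "card (W \<inter> (B - {x})) < card {d \<in> E'. d \<subseteq> W}"
      using ng unfolding good_def by (auto simp: not_le)
    have fW: "finite W" using W assms(1) finite_subset by blast
    have le: "card {d \<in> E'. d \<subseteq> W} \<le> card {d \<in> E. d \<subseteq> W}"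
      using fE by (intro card_mono) (auto simp: E'_def)
    have ub: "card {d \<in> E. d \<subseteq> W} \<le> card (W \<inter> B)" using Suc.prems(3) W by blast
    have x: "x \<in> W"
    proof (rule ccontr)
      assume "x \<notin> W"
      then have "W \<inter> (B - {x}) = W \<inter> B" by blast
      then show False using W le ub by simp
    qed
    have "card (W \<inter> B) = Suc (card (W \<inter> (B - {x})))"
      using x True fW by (metis Diff_Int_distrib Int_Diff Int_iff card_Suc_Diff1 finite_Int)
    then have lb: "card (W \<inter> B) \<le> card {d \<in> E'. d \<subseteq> W}" using W by simp
    have "y \<notin> W"
    proof
      assume "y \<in> W"
      then have "{d \<in> E. d \<subseteq> W} = insert e {d \<in> E'. d \<subseteq> W}" "e \<notin> {d \<in> E'. d \<subseteq> W}"
        using x xy e by (auto simp: E'_def)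
      then have "card {d \<in> E. d \<subseteq> W} = Suc (card {d \<in> E'. d \<subseteq> W})" using fE by simp
      then show False using lb ub by simp
    qed
    then show ?thesis using x lb le W by (meson le_trans)
  qed
  have "\<exists>x\<in>{u, v}. good x"
  proof (rule ccontr)
    assume "\<not> (\<exists>x\<in>{u, v}. good x)"
    then have ng: "\<not> good u" "\<not> good v" by auto
    obtain U where U: "U \<subseteq> V" "u \<in> U" "v \<notin> U" "card (U \<inter> B) \<le> card {d \<in> E. d \<subseteq> U}"
      using tight[OF uv(4,3,1) ng(1)] by blast
    obtain W where W: "W \<subseteq> V" "v \<in> W" "u \<notin> W" "card (W \<inter> B) \<le> card {d \<in> E. d \<subseteq> W}"
      using tight[of v u] uv ng(2) by (metis insert_commute)
    let ?A = "{d \<in> E. d \<subseteq> U}" and ?C = "{d \<in> E. d \<subseteq> W}"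
    \<comment> \<open>Capacities are modular and edge counts supermodular under union and
      intersection. Since \<open>e\<close> lies in the union of the two tight sets but in neither of
      them, the union spans one edge more than its capacity.\<close>
    have "card ?A + card ?C = card (?A \<union> ?C) + card (?A \<inter> ?C)"
      using fE by (intro card_Un_Int) auto
    moreover have "card (?A \<inter> ?C) = card {d \<in> E. d \<subseteq> U \<inter> W}" by (rule arg_cong[of _ _ card]) auto
    moreover have "card {d \<in> E. d \<subseteq> U \<inter> W} \<le> card (U \<inter> W \<inter> B)"
      by (rule Suc.prems(3)) (use U in blast)
    moreover have "card (insert e (?A \<union> ?C)) = Suc (card (?A \<union> ?C))"
      using fE uv U W by (intro card_insert_disjoint) auto
    moreover have "card (insert e (?A \<union> ?C)) \<le> card {d \<in> E. d \<subseteq> U \<union> W}"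
      using fE e uv U W by (intro card_mono) auto
    moreover have "card {d \<in> E. d \<subseteq> U \<union> W} \<le> card ((U \<union> W) \<inter> B)"
      by (rule Suc.prems(3)) (use U W in blast)
    moreover have "card (U \<inter> B) + card (W \<inter> B) = card ((U \<union> W) \<inter> B) + card (U \<inter> W \<inter> B)"
    proof -
      have "finite (U \<inter> B)" "finite (W \<inter> B)" using U W assms(1) finite_subset by blast+
      then have "card (U \<inter> B) + card (W \<inter> B) = card ((U \<inter> B) \<union> (W \<inter> B)) + card ((U \<inter> B) \<inter> (W \<inter> B))"
        by (rule card_Un_Int)
      moreover have "(U \<inter> B) \<union> (W \<inter> B) = (U \<union> W) \<inter> B" "(U \<inter> B) \<inter> (W \<inter> B) = U \<inter> W \<inter> B" by auto
      ultimately show ?thesis by simp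
    qed
    ultimately show False using U W by linarith
  qed
  then obtain x where x: "x \<in> e" "x \<in> B"
    and E': "\<And>W. W \<subseteq> V \<Longrightarrow> card {d \<in> E'. d \<subseteq> W} \<le> card (W \<inter> (B - {x}))"
    using uv unfolding good_def by blast
  have "n = card E'" using Suc.hyps(2) e fE by (simp add: E'_def)
  then obtain g where g: "inj_on g E'" "g ` E' \<subseteq> B - {x}" "\<forall>e\<in>E'. g e \<in> e"
    using Suc.hyps(1)[of E' "B - {x}"] fE E' Suc.prems(2) unfolding E'_def by blast
  have "E = insert e E'" "e \<notin> E'" using e by (auto simp: E'_def)
  moreover have "inj_on (g(e := x)) E'" "(g(e := x)) ` E' = g ` E'" "\<forall>d\<in>E'. (g(e := x)) d = g d"
    using g(1) \<open>e \<notin> E'\<close> by (auto simp: inj_on_def)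
  ultimately have "inj_on (g(e := x)) E \<and> (g(e := x)) ` E \<subseteq> B \<and> (\<forall>d\<in>E. (g(e := x)) d \<in> d)"
    using g x by auto
  then show ?case by blast
qed

lemma sparse_orientation:
  assumes "ordered_graph G" "sparse G"
  shows "\<exists>g. inj_on g (edges G) \<and> (\<forall>e\<in>edges G. g e \<in> e)"
proof -
  have "\<exists>g. inj_on g (edges G) \<and> g ` edges G \<subseteq> verts G \<and> (\<forall>e\<in>edges G. g e \<in> e)"
  proof (rule orientation_capacity[of "verts G"])
    show "\<exists>u v. u \<in> verts G \<and> v \<in> verts G \<and> u \<noteq> v \<and> e = {u, v}" if "e \<in> edges G" for e
      using ordered_graph_edgeD[OF assms(1) that] by blast
    show "card {e \<in> edges G. e \<subseteq> W} \<le> card (W \<inter> verts G)" if "W \<subseteq> verts G" for W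
      using assms(2) that unfolding sparse_def spanned_def by (simp add: Int_absorb2)
  qed (use assms finite_verts finite_edges in auto)
  then show ?thesis by blast
qed

text \<open>Allows sparsity of a concrete graph to be checked by naming an owner for each edge
  instead of inspecting all vertex subsets.\<close>

lemma sparse_if_orientation:
  assumes "finite (verts G)" "inj_on g (edges G)" "\<And>e. e \<in> edges G \<Longrightarrow> g e \<in> e"
  shows "sparse G"
  unfolding sparse_def
proof (intro allI impI)
  fix W assume "W \<subseteq> verts G"
  then have "finite W" using assms(1) finite_subset by blast
  moreover have "g ` spanned G W \<subseteq> W" using assms(3) by (auto simp: spanned_def)
  moreover have "inj_on g (spanned G W)" using assms(2) by (rule inj_on_subset) (auto simp: spanned_def)
  ultimately show "card (spanned G W) \<le> card W" by (simp add: card_inj_on_le)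
qed

section \<open>Ordered paths on three vertices\<close>

definition has_right :: "'a::linorder ograph \<Rightarrow> bool" where
  "has_right G \<longleftrightarrow> (\<exists>a b c. a < b \<and> a < c \<and> b \<noteq> c \<and> {a, b} \<in> edges G \<and> {a, c} \<in> edges G)"

definition has_left :: "'a::linorder ograph \<Rightarrow> bool" where
  "has_left G \<longleftrightarrow> (\<exists>a b c. b < a \<and> c < a \<and> b \<noteq> c \<and> {a, b} \<in> edges G \<and> {a, c} \<in> edges G)"

definition has_mono :: "'a::linorder ograph \<Rightarrow> bool" where
  "has_mono G \<longleftrightarrow> (\<exists>a b c. a < b \<and> b < c \<and> {a, b} \<in> edges G \<and> {b, c} \<in> edges G)"

lemma embedsE:
  assumes "embeds H G" "ordered_graph H"
  obtains p where "\<And>u v. {u, v} \<in> edges H \<Longrightarrow> {p u, p v} \<in> edges G"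
    "\<And>u v. u \<in> verts H \<Longrightarrow> v \<in> verts H \<Longrightarrow> p u < p v \<longleftrightarrow> u < v"
    "\<And>u v. u \<in> verts H \<Longrightarrow> v \<in> verts H \<Longrightarrow> p u = p v \<longleftrightarrow> u = v"
proof -
  obtain p where p: "strict_mono_on (verts H) p" "\<And>u v. {u, v} \<in> edges H \<Longrightarrow> {p u, p v} \<in> edges G"
    using assms unfolding embeds_def by blast
  show thesis
  proof (rule that[OF p(2)])
    fix u v assume "u \<in> verts H" "v \<in> verts H"
    then show "p u < p v \<longleftrightarrow> u < v" "p u = p v \<longleftrightarrow> u = v"
      using p(1) strict_mono_on_less strict_mono_on_eq by blast+
  qed
qed

lemma has_right_embeds:
  assumes "embeds H G" "ordered_graph H" "has_right H"
  shows "has_right G"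
proof -
  obtain a b c where h: "a < b" "a < c" "b \<noteq> c" "{a, b} \<in> edges H" "{a, c} \<in> edges H"
    using assms(3) unfolding has_right_def by blast
  have v: "a \<in> verts H" "b \<in> verts H" "c \<in> verts H" using ordered_graphD[OF assms(2)] h by auto
  show ?thesis using assms(1,2)
  proof (rule embedsE)
    fix p assume "\<And>u v. {u, v} \<in> edges H \<Longrightarrow> {p u, p v} \<in> edges G"
      "\<And>u v. u \<in> verts H \<Longrightarrow> v \<in> verts H \<Longrightarrow> p u < p v \<longleftrightarrow> u < v"
      "\<And>u v. u \<in> verts H \<Longrightarrow> v \<in> verts H \<Longrightarrow> p u = p v \<longleftrightarrow> u = v"
    then show ?thesis unfolding has_right_def using h v
      by (intro exI[of _ "p a"] exI[of _ "p b"] exI[of _ "p c"]) auto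
  qed
qed

lemma has_left_embeds:
  assumes "embeds H G" "ordered_graph H" "has_left H"
  shows "has_left G"
proof -
  obtain a b c where h: "b < a" "c < a" "b \<noteq> c" "{a, b} \<in> edges H" "{a, c} \<in> edges H"
    using assms(3) unfolding has_left_def by blast
  have v: "a \<in> verts H" "b \<in> verts H" "c \<in> verts H" using ordered_graphD[OF assms(2)] h by auto
  show ?thesis using assms(1,2)
  proof (rule embedsE)
    fix p assume "\<And>u v. {u, v} \<in> edges H \<Longrightarrow> {p u, p v} \<in> edges G"
      "\<And>u v. u \<in> verts H \<Longrightarrow> v \<in> verts H \<Longrightarrow> p u < p v \<longleftrightarrow> u < v"
      "\<And>u v. u \<in> verts H \<Longrightarrow> v \<in> verts H \<Longrightarrow> p u = p v \<longleftrightarrow> u = v"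
    then show ?thesis unfolding has_left_def using h v
      by (intro exI[of _ "p a"] exI[of _ "p b"] exI[of _ "p c"]) auto
  qed
qed

lemma has_mono_embeds:
  assumes "embeds H G" "ordered_graph H" "has_mono H"
  shows "has_mono G"
proof -
  obtain a b c where h: "a < b" "b < c" "{a, b} \<in> edges H" "{b, c} \<in> edges H"
    using assms(3) unfolding has_mono_def by blast
  have v: "a \<in> verts H" "b \<in> verts H" "c \<in> verts H" using ordered_graphD[OF assms(2)] h by auto
  show ?thesis using assms(1,2)
  proof (rule embedsE)
    fix p assume "\<And>u v. {u, v} \<in> edges H \<Longrightarrow> {p u, p v} \<in> edges G"
      "\<And>u v. u \<in> verts H \<Longrightarrow> v \<in> verts H \<Longrightarrow> p u < p v \<longleftrightarrow> u < v"
      "\<And>u v. u \<in> verts H \<Longrightarrow> v \<in> verts H \<Longrightarrow> p u = p v \<longleftrightarrow> u = v"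
    then show ?thesis unfolding has_mono_def using h v
      by (intro exI[of _ "p a"] exI[of _ "p b"] exI[of _ "p c"]) auto
  qed
qed

text \<open>Colour an edge according to whether its owner is the smaller or the larger endpoint.\<close>

lemma right_left_avoidable:
  assumes F: "ordered_graph F" "sparse F"
  obtains c where "\<not> has_right (colour_class F c Red)" "\<not> has_left (colour_class F c Blue)"
proof -
  obtain g where g: "inj_on g (edges F)" "\<And>e. e \<in> edges F \<Longrightarrow> g e \<in> e"
    using sparse_orientation[OF F] by blast
  define c where "c e = (if g e = Min e then Red else Blue)" for e
  have "\<not> has_right (colour_class F c Red)"
  proof
    assume "has_right (colour_class F c Red)"
    then obtain u x y where "u < x" "u < y" "x \<noteq> y" "{u, x} \<in> edges F" "{u, y} \<in> edges F"
      "c {u, x} = Red" "c {u, y} = Red" unfolding has_right_def by auto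
    moreover then have "g {u, x} = u" "g {u, y} = u"
      by (auto simp: c_def min_absorb1 split: if_splits)
    ultimately have "{u, x} = {u, y}" by (intro inj_onD[OF g(1)]) simp_all
    then show False using \<open>x \<noteq> y\<close> by (auto simp: doubleton_eq_iff)
  qed
  moreover have "\<not> has_left (colour_class F c Blue)"
  proof
    assume "has_left (colour_class F c Blue)"
    then obtain u x y where h: "x < u" "y < u" "x \<noteq> y" "{u, x} \<in> edges F" "{u, y} \<in> edges F"
      "c {u, x} = Blue" "c {u, y} = Blue" unfolding has_left_def by auto
    then have "g {u, x} \<noteq> x" "g {u, y} \<noteq> y"
      by (auto simp: c_def min_absorb2 split: if_splits)
    then have "g {u, x} = u" "g {u, y} = u" using g(2) h by blast+
    then have "{u, x} = {u, y}" using h by (intro inj_onD[OF g(1)]) simp_all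
    then show False using h by (auto simp: doubleton_eq_iff)
  qed
  ultimately show thesis using that by blast
qed

lemma connected_graph_closed:
  assumes "connected_graph G" "a \<in> A" "a \<in> verts G"
    and "\<And>x y. {x, y} \<in> edges G \<Longrightarrow> x \<in> A \<Longrightarrow> y \<in> A"
  shows "verts G \<subseteq> A"
proof
  fix v assume "v \<in> verts G"
  then have "(a, v) \<in> {(x, y). {x, y} \<in> edges G}\<^sup>*"
    using assms(1,3) unfolding connected_graph_def by blast
  then show "v \<in> A" by induction (use assms(2,4) in auto)
qed

text \<open>With \<open>t v\<close> saying that \<open>v\<close> owns no edge to its left, the edges inside the classes of \<open>t\<close>
  become blue. Then every blue component has at most one right or at most one left neighbour at
  each vertex.\<close>

lemma mono_zigzag_avoidable:
  assumes F: "ordered_graph F" "sparse F"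
    and H: "ordered_graph H" "connected_graph H" "has_right H" "has_left H"
  obtains c where "\<not> has_mono (colour_class F c Red)" "\<not> embeds H (colour_class F c Blue)"
proof -
  obtain g where g: "inj_on g (edges F)" "\<And>e. e \<in> edges F \<Longrightarrow> g e \<in> e"
    using sparse_orientation[OF F] by blast
  have own: "x = y" if "{v, x} \<in> edges F" "{v, y} \<in> edges F" "g {v, x} = v" "g {v, y} = v" for v x y
  proof -
    have "{v, x} = {v, y}" by (rule inj_onD[OF g(1)]) (use that in simp_all)
    then show ?thesis by (auto simp: doubleton_eq_iff)
  qed
  have owner: "g {u, v} = u \<or> g {u, v} = v" if "{u, v} \<in> edges F" for u v
    using g(2)[OF that] by blast
  define t where "t v \<longleftrightarrow> \<not> (\<exists>u < v. {v, u} \<in> edges F \<and> g {v, u} = v)" for v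
  define c where "c e = (if \<forall>u\<in>e. \<forall>v\<in>e. t u = t v then Blue else Red)" for e
  have red: "t u \<noteq> t v" if "c {u, v} = Red" for u v
    using that by (auto simp: c_def split: if_splits)
  have blue: "t u = t v" if "c {u, v} = Blue" for u v
    using that by (auto simp: c_def split: if_splits)
  have "\<not> has_mono (colour_class F c Red)"
  proof
    assume "has_mono (colour_class F c Red)"
    then obtain u v w where h: "u < v" "v < w" "{u, v} \<in> edges F" "{v, w} \<in> edges F"
      "c {u, v} = Red" "c {v, w} = Red" unfolding has_mono_def by auto
    \<comment> \<open>An edge \<open>{x, y}\<close> with \<open>x < y\<close>, \<open>t x\<close>
      false and \<open>t y\<close> true has no possible owner: \<open>x\<close> already owns an edge
      to its left, and \<open>y\<close> owns none. Along a red monotone path \<open>t\<close>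
      alternates, so one of the two edges is of this kind.\<close>
    show False
    proof (cases "t v")
      case True
      then have "\<not> t u" using red[OF h(5)] by simp
      then obtain z where "z < u" "{u, z} \<in> edges F" "g {u, z} = u" unfolding t_def by blast
      then have "g {u, v} \<noteq> u" using own[of u z v] h by auto
      then have "g {v, u} = v" using owner[OF h(3)] by (simp add: insert_commute)
      then show False using True h unfolding t_def by (metis insert_commute)
    next
      case False
      then have "t w" using red[OF h(6)] by simp
      then have "g {v, w} \<noteq> w" using h unfolding t_def by (metis insert_commute)
      then have "g {v, w} = v" using owner[OF h(4)] by simp
      moreover obtain z where "z < v" "{v, z} \<in> edges F" "g {v, z} = v"
        using False unfolding t_def by blast
      ultimately show False using own[of v z w] h by auto
    qed
  qed
  moreover have "\<not> embeds H (colour_class F c Blue)"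
  proof
    assume "embeds H (colour_class F c Blue)"
    then show False using H(1)
    proof (rule embedsE)
      fix p assume p: "\<And>u v. {u, v} \<in> edges H \<Longrightarrow> {p u, p v} \<in> edges (colour_class F c Blue)"
        and less: "\<And>u v. u \<in> verts H \<Longrightarrow> v \<in> verts H \<Longrightarrow> p u < p v \<longleftrightarrow> u < v"
        and eq: "\<And>u v. u \<in> verts H \<Longrightarrow> v \<in> verts H \<Longrightarrow> p u = p v \<longleftrightarrow> u = v"
      obtain r x y where r: "r < x" "r < y" "x \<noteq> y" "{r, x} \<in> edges H" "{r, y} \<in> edges H"
        using H(3) unfolding has_right_def by blast
      obtain l v w where l: "v < l" "w < l" "v \<noteq> w" "{l, v} \<in> edges H" "{l, w} \<in> edges H"
        using H(4) unfolding has_left_def by blast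
      have V: "r \<in> verts H" "x \<in> verts H" "y \<in> verts H" "l \<in> verts H" "v \<in> verts H" "w \<in> verts H"
        using ordered_graphD[OF H(1)] r l by auto
      \<comment> \<open>Blue edges stay inside a class of \<open>t\<close>, so a connected blue copy
        lies in one class. Where \<open>t\<close> holds, a right endpoint owns no edge to its left,
        so each edge belongs to its left endpoint and right stars are excluded. Where
        \<open>t\<close> fails, every left endpoint is occupied by an edge further left, so each
        edge belongs to its right endpoint and left stars are excluded.\<close>
      have "verts H \<subseteq> {z. t (p z) = t (p r)}"
      proof (rule connected_graph_closed[OF H(2) _ V(1)])
        fix a b assume ab: "{a, b} \<in> edges H" and a: "a \<in> {z. t (p z) = t (p r)}"
        have "t (p a) = t (p b)" using p[OF ab] by (intro blue) simp
        then show "b \<in> {z. t (p z) = t (p r)}" using a by simp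
      qed simp
      then have const: "t (p z) = t (p r)" if "z \<in> verts H" for z using that by blast
      show False
      proof (cases "t (p r)")
        case True
        have "g {p r, p z} = p r" if "r < z" "{r, z} \<in> edges H" "z \<in> verts H" for z
        proof -
          have "t (p z)" "p r < p z" "{p z, p r} \<in> edges F" "{p r, p z} \<in> edges F"
            using True const[OF that(3)] less[OF V(1) that(3)] that(1) p[OF that(2)]
            by (simp_all add: insert_commute)
          then have "g {p r, p z} \<noteq> p z" unfolding t_def by (metis insert_commute)
          then show ?thesis using owner \<open>{p r, p z} \<in> edges F\<close> by blast
        qed
        then have "p x = p y" using own[of "p r" "p x" "p y"] p r V by simp
        then show False using eq V r by simp
      next
        case False
        have "g {p l, p z} = p l" if "z < l" "{l, z} \<in> edges H" "z \<in> verts H" for z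
        proof -
          have z: "\<not> t (p z)" "p z < p l" "{p z, p l} \<in> edges F" "{p l, p z} \<in> edges F"
            using False const[OF that(3)] less[OF that(3) V(4)] that(1) p[OF that(2)]
            by (simp_all add: insert_commute)
          then obtain q where "q < p z" "{p z, q} \<in> edges F" "g {p z, q} = p z"
            unfolding t_def by blast
          then have "g {p z, p l} \<noteq> p z" using own[of "p z" q "p l"] z by auto
          then show ?thesis using owner[OF z(4)] by (simp add: insert_commute)
        qed
        then have "p v = p w" using own[of "p l" "p v" "p w"] p l V by simp
        then show False using eq V l by simp
      qed
    qed
  qed
  ultimately show thesis using that by blast
qed

section \<open>Nearly proper vertex colourings\<close>

definition degree :: "'a ograph \<Rightarrow> 'a \<Rightarrow> nat" where
  "degree G v = card {e \<in> edges G. v \<in> e}"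

lemma sum_degree:
  assumes "ordered_graph G"
  shows "(\<Sum>v\<in>verts G. degree G v) = 2 * card (edges G)"
  unfolding degree_def
proof (rule sum_multicount)
  show "\<forall>e\<in>edges G. card {v \<in> verts G. v \<in> e} = 2"
  proof
    fix e assume "e \<in> edges G"
    then obtain u v where e: "e = {u, v}" "u < v" "u \<in> verts G" "v \<in> verts G"
      using ordered_graph_edgeD[OF assms] by blast
    then have "{v \<in> verts G. v \<in> e} = {u, v}" by auto
    then show "card {v \<in> verts G. v \<in> e} = 2" using e by simp
  qed
qed (use assms finite_verts finite_edges in auto)

lemma degree_le_1_unique:
  assumes "ordered_graph G" "degree G v \<le> 1" "{v, x} \<in> edges G" "{v, y} \<in> edges G"
  shows "x = y"
proof -
  have "finite {e \<in> edges G. v \<in> e}" using finite_edges[OF assms(1)] by simp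
  moreover have "card {e \<in> edges G. v \<in> e} \<le> Suc 0" using assms(2) by (simp add: degree_def)
  ultimately have "d = e" if "d \<in> {e \<in> edges G. v \<in> e}" "e \<in> {e \<in> edges G. v \<in> e}" for d e
    using card_le_Suc0_iff_eq that by blast
  then have "{v, x} = {v, y}" using assms(3,4) by simp
  then show ?thesis by (auto simp: doubleton_eq_iff)
qed

lemma degree_ge_2_neighbours:
  assumes "ordered_graph G" "2 \<le> degree G v"
  shows "\<exists>x y. x \<noteq> y \<and> {v, x} \<in> edges G \<and> {v, y} \<in> edges G"
proof -
  let ?S = "{e \<in> edges G. v \<in> e}"
  have "finite ?S" using finite_edges[OF assms(1)] by simp
  then have "\<not> (\<forall>d\<in>?S. \<forall>e\<in>?S. d = e)"
    using assms(2) card_le_Suc0_iff_eq[of ?S] unfolding degree_def by linarith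
  then obtain d e where de: "d \<in> edges G" "v \<in> d" "e \<in> edges G" "v \<in> e" "d \<noteq> e" by blast
  have *: "\<exists>x. b = {v, x}" if b: "b \<in> edges G" "v \<in> b" for b
  proof -
    obtain p q where "b = {p, q}" using ordered_graph_edgeD[OF assms(1) b(1)] by blast
    then have "b = {v, p} \<or> b = {v, q}" using b(2) by auto
    then show ?thesis by blast
  qed
  obtain x y where "d = {v, x}" "e = {v, y}" using *[OF de(1,2)] *[OF de(3,4)] by blast
  then show ?thesis using de by blast
qed

lemma strictly_sparse_induced:
  "strictly_sparse G \<Longrightarrow> W \<subseteq> verts G \<Longrightarrow> strictly_sparse (induced G W)"
  unfolding strictly_sparse_def induced_simps by (simp add: subset_trans)

lemma spanned_verts: "ordered_graph G \<Longrightarrow> spanned G (verts G) = edges G"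
  using edges_subset_Pow by (auto simp: spanned_def)

text \<open>The average degree is below 2.\<close>

lemma strictly_sparse_low_degree:
  assumes "ordered_graph G" "strictly_sparse G" "verts G \<noteq> {}"
  shows "\<exists>v\<in>verts G. degree G v \<le> 1"
proof (rule ccontr)
  assume "\<not> ?thesis"
  then have "(\<Sum>v\<in>verts G. 2) \<le> (\<Sum>v\<in>verts G. degree G v)"
    by (intro sum_mono) (fastforce simp: not_le)
  moreover have "card (edges G) < card (verts G)"
    using assms unfolding strictly_sparse_def by (metis order_refl spanned_verts)
  ultimately show False using sum_degree[OF assms(1)] by simp
qed

text \<open>Induction by deleting a vertex of degree at most 1, which can afterwards take the colour
  opposite to that of its only neighbour.\<close>

lemma proper_2_colouring:
  assumes "ordered_graph G" "strictly_sparse G"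
  shows "\<exists>s :: 'a::linorder \<Rightarrow> bool. \<forall>u v. {u, v} \<in> edges G \<longrightarrow> s u \<noteq> s v"
  using assms
proof (induction "card (verts G)" arbitrary: G)
  case 0
  then have "verts G = {}" using finite_verts[OF 0(2)] by simp
  then have "edges G = {}" using ordered_graph_edgeD[OF 0(2)] by blast
  then show ?case by simp
next
  case (Suc n)
  then have "verts G \<noteq> {}" by auto
  then obtain l where l: "l \<in> verts G" "degree G l \<le> 1"
    using strictly_sparse_low_degree Suc.prems by blast
  let ?G = "induced G (verts G - {l})"
  have "n = card (verts ?G)" using Suc.hyps(2) l by (simp add: finite_verts Suc.prems)
  moreover have "ordered_graph ?G" "strictly_sparse ?G"
    using ordered_graph_induced[OF Suc.prems(1)] strictly_sparse_induced[OF Suc.prems(2)] by auto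
  ultimately obtain s :: "'a \<Rightarrow> bool" where "\<forall>u v. {u, v} \<in> edges ?G \<longrightarrow> s u \<noteq> s v"
    using Suc.hyps(1)[of ?G] by metis
  then have s: "s u \<noteq> s v" if "{u, v} \<in> edges ?G" for u v using that by metis
  \<comment> \<open>The neighbour of \<open>l\<close>. If \<open>l\<close> is isolated,
    \<open>p\<close> is arbitrary, and so may be the colour of \<open>l\<close>.\<close>
  define p where "p = (SOME p. {l, p} \<in> edges G)"
  have p: "x = p" if "{l, x} \<in> edges G" for x
    using degree_le_1_unique[OF Suc.prems(1) l(2) that] someI[of "\<lambda>p. {l, p} \<in> edges G", OF that]
    unfolding p_def by blast
  define s' where "s' = s(l := \<not> s p)"
  have "s' u \<noteq> s' v" if e: "{u, v} \<in> edges G" for u v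
  proof -
    have uv: "u \<noteq> v" "u \<in> verts G" "v \<in> verts G" using ordered_graphD[OF Suc.prems(1) e] by auto
    consider "u = l" | "v = l" | "u \<noteq> l" "v \<noteq> l" by blast
    then show ?thesis
    proof cases
      case 1
      then show ?thesis using p[of v] e uv by (auto simp: s'_def)
    next
      case 2
      then have "u = p" using p[of u] e by (simp add: insert_commute)
      then show ?thesis using 2 uv by (auto simp: s'_def)
    next
      case 3
      then have "{u, v} \<in> edges ?G" using e uv by (auto simp: spanned_def)
      then show ?thesis using s 3 by (simp add: s'_def)
    qed
  qed
  then show ?case by blast
qed

text \<open>The pairs in \<open>X\<close> are the exceptional edges, whose two endpoints share the colour
  \<^term>\<open>True\<close>. The two values of \<open>m\<close> give two incompatible ways of controlling paths that
  consist of exceptional edges.\<close>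

definition near_proper ::
  "bool \<Rightarrow> 'a::linorder ograph \<Rightarrow> ('a \<Rightarrow> bool) \<Rightarrow> ('a \<times> 'a) set \<Rightarrow> bool" where
  "near_proper m G s X \<longleftrightarrow>
     (\<forall>u v. (u, v) \<in> X \<longrightarrow> u < v \<and> {u, v} \<in> edges G \<and> s u \<and> s v) \<and>
     (\<forall>u v. {u, v} \<in> edges G \<longrightarrow> u < v \<longrightarrow> (u, v) \<notin> X \<longrightarrow> s u \<noteq> s v) \<and>
     (\<forall>u v w. (u, v) \<in> X \<longrightarrow> (u, w) \<in> X \<longrightarrow> v = w) \<and>
     (m \<longrightarrow> (\<forall>u v w. {u, v} \<in> edges G \<longrightarrow> u < v \<longrightarrow> (v, w) \<in> X \<longrightarrow> (u, v) \<in> X)) \<and>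
     (\<not> m \<longrightarrow> (\<forall>u v w. (u, v) \<in> X \<longrightarrow> (v, w) \<notin> X))"

lemma near_properI:
  assumes "\<And>u v. (u, v) \<in> X \<Longrightarrow> u < v \<and> {u, v} \<in> edges G \<and> s u \<and> s v"
    and "\<And>u v. {u, v} \<in> edges G \<Longrightarrow> u < v \<Longrightarrow> (u, v) \<notin> X \<Longrightarrow> s u \<noteq> s v"
    and "\<And>u v w. (u, v) \<in> X \<Longrightarrow> (u, w) \<in> X \<Longrightarrow> v = w"
    and "\<And>u v w. m \<Longrightarrow> {u, v} \<in> edges G \<Longrightarrow> u < v \<Longrightarrow> (v, w) \<in> X \<Longrightarrow> (u, v) \<in> X"
    and "\<And>u v w. \<not> m \<Longrightarrow> (u, v) \<in> X \<Longrightarrow> (v, w) \<in> X \<Longrightarrow> False"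
  shows "near_proper m G s X"
  unfolding near_proper_def
proof (intro conjI)
  show "\<forall>u v. (u, v) \<in> X \<longrightarrow> u < v \<and> {u, v} \<in> edges G \<and> s u \<and> s v" using assms(1) by simp
  show "\<forall>u v. {u, v} \<in> edges G \<longrightarrow> u < v \<longrightarrow> (u, v) \<notin> X \<longrightarrow> s u \<noteq> s v" using assms(2) by simp
  show "\<forall>u v w. (u, v) \<in> X \<longrightarrow> (u, w) \<in> X \<longrightarrow> v = w" using assms(3) by blast
  show "m \<longrightarrow> (\<forall>u v w. {u, v} \<in> edges G \<longrightarrow> u < v \<longrightarrow> (v, w) \<in> X \<longrightarrow> (u, v) \<in> X)"
    using assms(4) by blast
  show "\<not> m \<longrightarrow> (\<forall>u v w. (u, v) \<in> X \<longrightarrow> (v, w) \<notin> X)" using assms(5) by blast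
qed

lemma near_properD:
  assumes "near_proper m G s X"
  shows "(u, v) \<in> X \<Longrightarrow> u < v" "(u, v) \<in> X \<Longrightarrow> {u, v} \<in> edges G"
    "(u, v) \<in> X \<Longrightarrow> s u" "(u, v) \<in> X \<Longrightarrow> s v"
    "{u, v} \<in> edges G \<Longrightarrow> u < v \<Longrightarrow> (u, v) \<notin> X \<Longrightarrow> s u \<noteq> s v"
    "(u, v) \<in> X \<Longrightarrow> (u, w) \<in> X \<Longrightarrow> v = w"
    "m \<Longrightarrow> {u, v} \<in> edges G \<Longrightarrow> u < v \<Longrightarrow> (v, w) \<in> X \<Longrightarrow> (u, v) \<in> X"
    "\<not> m \<Longrightarrow> (u, v) \<in> X \<Longrightarrow> (v, w) \<notin> X"
proof -
  note np = assms[unfolded near_proper_def]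
  note 1 = np[THEN conjunct1] and 2 = np[THEN conjunct2, THEN conjunct1]
    and 3 = np[THEN conjunct2, THEN conjunct2, THEN conjunct1]
    and 4 = np[THEN conjunct2, THEN conjunct2, THEN conjunct2, THEN conjunct1]
    and 5 = np[THEN conjunct2, THEN conjunct2, THEN conjunct2, THEN conjunct2]
  show "(u, v) \<in> X \<Longrightarrow> u < v" "(u, v) \<in> X \<Longrightarrow> {u, v} \<in> edges G"
    "(u, v) \<in> X \<Longrightarrow> s u" "(u, v) \<in> X \<Longrightarrow> s v" using 1 by simp_all
  show "{u, v} \<in> edges G \<Longrightarrow> u < v \<Longrightarrow> (u, v) \<notin> X \<Longrightarrow> s u \<noteq> s v" using 2 by simp
  show "(u, v) \<in> X \<Longrightarrow> (u, w) \<in> X \<Longrightarrow> v = w" using 3 by blast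
  show "m \<Longrightarrow> {u, v} \<in> edges G \<Longrightarrow> u < v \<Longrightarrow> (v, w) \<in> X \<Longrightarrow> (u, v) \<in> X" using 4 by blast
  show "\<not> m \<Longrightarrow> (u, v) \<in> X \<Longrightarrow> (v, w) \<notin> X" using 5 by blast
qed

text \<open>Usually the leaf takes the colour opposite to its neighbour and no edge becomes
  exceptional. The one obstruction arises for \<open>m\<close> true, when the neighbour lies to the
  right and starts an exceptional edge: then the leaf edge must be exceptional too. This is
  consistent, since the neighbour already has colour \<open>True\<close> and the leaf starts no
  other edge.\<close>

lemma near_proper_add_leaf:
  assumes G: "ordered_graph G" and l: "l \<in> verts G" "degree G l \<le> 1"
    and np: "near_proper m (induced G (verts G - {l})) s X"
  shows "\<exists>s X. near_proper m G s X"
proof -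
  let ?G = "induced G (verts G - {l})"
  note np = near_properD[OF np]
  have old: "{u, v} \<in> edges G \<and> u \<noteq> l \<and> v \<noteq> l" if "{u, v} \<in> edges ?G" for u v
    using that by (auto simp: spanned_def)
  have new: "{u, v} \<in> edges ?G" if "{u, v} \<in> edges G" "u \<noteq> l" "v \<noteq> l" for u v
    using that ordered_graphD[OF G that(1)] by (auto simp: spanned_def)
  have Xl: "u \<noteq> l" "v \<noteq> l" if "(u, v) \<in> X" for u v using old[OF np(2)[OF that]] by simp_all
  define p where "p = (SOME p. {l, p} \<in> edges G)"
  have p: "x = p" if "{l, x} \<in> edges G" for x
    using degree_le_1_unique[OF G l(2) that] someI[of "\<lambda>p. {l, p} \<in> edges G", OF that]
    unfolding p_def by blast
  have p': "x = p" if "{x, l} \<in> edges G" for x using p that by (simp add: insert_commute)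
  show ?thesis
  proof (cases "m \<and> {l, p} \<in> edges G \<and> l < p \<and> (\<exists>d. (p, d) \<in> X)")
    case True
    then obtain d where d: "(p, d) \<in> X" and m: m and lp: "{l, p} \<in> edges G" "l < p" by blast
    have "near_proper m G (s(l := True)) (insert (l, p) X)"
    proof (rule near_properI)
      fix u v assume "(u, v) \<in> insert (l, p) X"
      then show "u < v \<and> {u, v} \<in> edges G \<and> (s(l := True)) u \<and> (s(l := True)) v"
        using lp np(1-4)[of u v] np(3)[OF d] old[of u v] by auto
    next
      fix u v assume e: "{u, v} \<in> edges G" "u < v" "(u, v) \<notin> insert (l, p) X"
      have "u \<noteq> l" "v \<noteq> l" using p[of v] p'[of u] e lp by auto
      then show "(s(l := True)) u \<noteq> (s(l := True)) v" using np(5) new e by simp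
    next
      fix u v w assume "(u, v) \<in> insert (l, p) X" "(u, w) \<in> insert (l, p) X"
      then show "v = w" using Xl[of u v] Xl[of u w] np(6)[of u v w] by auto
    next
      fix u v w assume e: "{u, v} \<in> edges G" "u < v" "(v, w) \<in> insert (l, p) X"
      have "v \<noteq> l" using p'[of u] e lp by auto
      then have "(v, w) \<in> X" using e by auto
      then show "(u, v) \<in> insert (l, p) X"
        using np(7)[OF m new[OF e(1)] e(2)] p[of v] e \<open>v \<noteq> l\<close> by (cases "u = l") auto
    qed (use m in simp)
    then show ?thesis by blast
  next
    case False
    have "near_proper m G (s(l := \<not> s p)) X"
    proof (rule near_properI)
      fix u v assume uv: "(u, v) \<in> X"
      then show "u < v \<and> {u, v} \<in> edges G \<and> (s(l := \<not> s p)) u \<and> (s(l := \<not> s p)) v"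
        using np(1-4)[OF uv] Xl[OF uv] old[OF np(2)[OF uv]] by simp
    next
      fix u v assume e: "{u, v} \<in> edges G" "u < v" "(u, v) \<notin> X"
      consider "u = l" "v \<noteq> l" | "v = l" "u \<noteq> l" | "u \<noteq> l" "v \<noteq> l" using e by auto
      then show "(s(l := \<not> s p)) u \<noteq> (s(l := \<not> s p)) v"
        using np(5)[OF new[OF e(1)] e(2,3)] p[of v] p'[of u] e(1) by cases auto
    next
      fix u v w assume "(u, v) \<in> X" "(u, w) \<in> X"
      then show "v = w" by (rule np(6))
    next
      fix u v w assume e: m "{u, v} \<in> edges G" "u < v" "(v, w) \<in> X"
      have "u \<noteq> l"
      proof
        assume "u = l"
        then have "v = p" using p[of v] e(2) by simp
        then show False using False e \<open>u = l\<close> by blast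
      qed
      then show "(u, v) \<in> X" using np(7)[OF e(1) new[OF e(2)] e(3,4)] Xl[OF e(4)] by blast
    next
      fix u v w assume "\<not> m" "(u, v) \<in> X" "(v, w) \<in> X"
      then show False using np(8)[of u v w] by simp
    qed
    then show ?thesis by blast
  qed
qed

lemma near_proper_disjoint_union:
  assumes G: "ordered_graph G"
    and A: "\<And>u v. {u, v} \<in> edges G \<Longrightarrow> u \<in> A \<Longrightarrow> v \<in> A"
    and s: "near_proper m (induced G (verts G \<inter> A)) s X"
    and t: "near_proper m (induced G (verts G - A)) t Y"
  shows "near_proper m G (\<lambda>v. if v \<in> A then s v else t v) (X \<union> Y)"
proof -
  note s = near_properD[OF s] and t = near_properD[OF t]
  have eq: "u \<in> A \<longleftrightarrow> v \<in> A" if "{u, v} \<in> edges G" for u v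
    using A that by (metis insert_commute)
  have X: "u \<in> A" "v \<in> A" "{u, v} \<in> edges G" if "(u, v) \<in> X" for u v
    using s(2)[OF that] by (auto simp: spanned_def)
  have Y: "u \<notin> A" "v \<notin> A" "{u, v} \<in> edges G" if "(u, v) \<in> Y" for u v
    using t(2)[OF that] by (auto simp: spanned_def)
  have inA: "{u, v} \<in> edges (induced G (verts G \<inter> A))" if "{u, v} \<in> edges G" "u \<in> A" for u v
    using that ordered_graphD[OF G that(1)] eq[OF that(1)] by (auto simp: spanned_def)
  have notinA: "{u, v} \<in> edges (induced G (verts G - A))" if "{u, v} \<in> edges G" "u \<notin> A" for u v
    using that ordered_graphD[OF G that(1)] eq[OF that(1)] by (auto simp: spanned_def)
  show ?thesis
  proof (rule near_properI)
    fix u v assume "(u, v) \<in> X \<union> Y"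
    then show "u < v \<and> {u, v} \<in> edges G \<and> (if u \<in> A then s u else t u) \<and> (if v \<in> A then s v else t v)"
      using X[of u v] Y[of u v] s(1,3,4)[of u v] t(1,3,4)[of u v] by auto
  next
    fix u v assume e: "{u, v} \<in> edges G" "u < v" "(u, v) \<notin> X \<union> Y"
    show "(if u \<in> A then s u else t u) \<noteq> (if v \<in> A then s v else t v)"
      using s(5)[OF inA[OF e(1)] e(2)] t(5)[OF notinA[OF e(1)] e(2)] e(3) eq[OF e(1)] by auto
  next
    fix u v w assume "(u, v) \<in> X \<union> Y" "(u, w) \<in> X \<union> Y"
    then show "v = w" using X(1) Y(1) s(6)[of u v w] t(6)[of u v w] by blast
  next
    fix u v w assume e: m "{u, v} \<in> edges G" "u < v" "(v, w) \<in> X \<union> Y"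
    then show "(u, v) \<in> X \<union> Y"
      using s(7)[OF e(1) inA[OF e(2)] e(3)] t(7)[OF e(1) notinA[OF e(2)] e(3)] eq[OF e(2)] X(1) Y(1)
      by blast
  next
    fix u v w assume "\<not> m" "(u, v) \<in> X \<union> Y" "(v, w) \<in> X \<union> Y"
    then show False using X(1,2) Y(1,2) s(8)[of u v w] t(8)[of u v w] by blast
  qed
qed

text \<open>Deleting the leftmost vertex \<open>r\<close> leaves a forest, whose proper 2-colouring
  extends to \<open>r\<close> unless the two neighbours of \<open>r\<close> differ. In that case one
  edge at \<open>r\<close> becomes exceptional. As nothing lies to the left of \<open>r\<close>,
  this edge is neither entered from the left nor part of two consecutive exceptional edges, so one
  construction serves both values of \<open>m\<close>.\<close>

lemma near_proper_cycle:
  fixes G :: "'a::linorder ograph"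
  assumes G: "ordered_graph G" "verts G \<noteq> {}" and deg: "\<And>v. v \<in> verts G \<Longrightarrow> degree G v = 2"
    and conn: "\<And>A. A \<subseteq> verts G \<Longrightarrow> A \<noteq> {} \<Longrightarrow> A \<noteq> verts G \<Longrightarrow>
      \<exists>u v. {u, v} \<in> edges G \<and> u \<in> A \<and> v \<notin> A"
  shows "\<exists>s X. near_proper m G s X"
proof -
  define r where "r = Min (verts G)"
  have fin: "finite (verts G)" using finite_verts[OF G(1)] .
  have r: "r \<in> verts G" "\<And>v. v \<in> verts G \<Longrightarrow> r \<le> v" using fin G(2) by (auto simp: r_def)
  let ?G = "induced G (verts G - {r})"
  have oG: "ordered_graph ?G" by (rule ordered_graph_induced[OF G(1)]) auto
  have "strictly_sparse ?G" unfolding strictly_sparse_def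
  proof (intro allI impI)
    fix W assume "W \<subseteq> verts ?G" and ne: "W \<noteq> {}"
    then have W: "W \<subseteq> verts G" "r \<notin> W" by auto
    have oW: "ordered_graph (induced G W)" by (rule ordered_graph_induced[OF G(1) W(1)])
    \<comment> \<open>\<open>W\<close> is nonempty and misses \<open>r\<close>, so some edge leaves
      it. Hence the degrees inside \<open>W\<close> sum to less than
      \<open>2 * card W\<close>.\<close>
    obtain u v where uv: "{u, v} \<in> edges G" "u \<in> W" "v \<notin> W" using conn[of W] W ne r by blast
    have fE: "finite {e \<in> edges G. w \<in> e}" for w using finite_edges[OF G(1)] by simp
    have sub: "{e \<in> edges (induced G W). w \<in> e} \<subseteq> {e \<in> edges G. w \<in> e}" for w
      by (auto simp: spanned_def)
    have "degree (induced G W) w \<le> degree G w" for w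
      unfolding degree_def by (rule card_mono[OF fE sub])
    moreover have "degree (induced G W) u < degree G u"
      unfolding degree_def
    proof (rule psubset_card_mono[OF fE])
      have "{u, v} \<in> {e \<in> edges G. u \<in> e}" "{u, v} \<notin> {e \<in> edges (induced G W). u \<in> e}"
        using uv by (auto simp: spanned_def)
      then show "{e \<in> edges (induced G W). u \<in> e} \<subset> {e \<in> edges G. u \<in> e}"
        using sub[of u] by blast
    qed
    ultimately have "(\<Sum>w\<in>W. degree (induced G W) w) < (\<Sum>w\<in>W. degree G w)"
      using W fin finite_subset uv(2) by (intro sum_strict_mono_ex1) auto
    also have "\<dots> = 2 * card W" using deg W by (simp add: subset_iff)
    finally have "card (spanned G W) < card W" using sum_degree[OF oW] by simp
    then show "card (spanned ?G W) < card W" using W by (simp add: subset_Diff_insert)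
  qed
  then obtain s :: "'a \<Rightarrow> bool" where s: "\<And>u v. {u, v} \<in> edges ?G \<Longrightarrow> s u \<noteq> s v"
    using proper_2_colouring[OF oG] by blast
  have new: "{u, v} \<in> edges ?G" if "{u, v} \<in> edges G" "u \<noteq> r" "v \<noteq> r" for u v
    using that ordered_graphD[OF G(1) that(1)] by (auto simp: spanned_def)
  obtain y z where yz: "{r, y} \<in> edges G" "{r, z} \<in> edges G" "y \<noteq> z"
    using degree_ge_2_neighbours[OF G(1), of r] deg[OF r(1)] by auto
  have nbr: "v = y \<or> v = z" if "{r, v} \<in> edges G" for v
  proof (rule ccontr)
    assume "\<not> ?thesis"
    then have "card {{r, v}, {r, y}, {r, z}} = 3" using yz(3) by (auto simp: doubleton_eq_iff)
    moreover have "card {{r, v}, {r, y}, {r, z}} \<le> degree G r"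
      unfolding degree_def using yz that finite_edges[OF G(1)] by (intro card_mono) auto
    ultimately show False using deg[OF r(1)] by simp
  qed
  show ?thesis
  proof (cases "s y = s z")
    case True
    have "near_proper m G (s(r := \<not> s y)) {}"
    proof (rule near_properI)
      fix u v assume e: "{u, v} \<in> edges G" "u < v"
      then have "v \<noteq> r" using r(2)[of u] ordered_graphD[OF G(1) e(1)] by auto
      then show "(s(r := \<not> s y)) u \<noteq> (s(r := \<not> s y)) v"
        using nbr[of v] s[OF new[OF e(1)]] e True by (cases "u = r") auto
    qed auto
    then show ?thesis by blast
  next
    case False
    \<comment> \<open>The only neighbour of \<open>r\<close> coloured \<open>True\<close>; both ends
      of an exceptional edge need this colour.\<close>
    define x where "x = (if s y then y else z)"
    have x: "s x" "{r, x} \<in> edges G" "\<And>v. {r, v} \<in> edges G \<Longrightarrow> v \<noteq> x \<Longrightarrow> \<not> s v"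
    proof -
      show "s x" "{r, x} \<in> edges G" using False yz by (auto simp: x_def)
      fix v assume "{r, v} \<in> edges G" "v \<noteq> x"
      then show "\<not> s v" using nbr[of v] False by (auto simp: x_def split: if_splits)
    qed
    have rx: "r < x" using r(2)[of x] ordered_graphD[OF G(1) x(2)] by auto
    have "near_proper m G (s(r := True)) {(r, x)}"
    proof (rule near_properI)
      fix u v assume e: "{u, v} \<in> edges G" "u < v" "(u, v) \<notin> {(r, x)}"
      then have "v \<noteq> r" using r(2)[of u] ordered_graphD[OF G(1) e(1)] by auto
      then show "(s(r := True)) u \<noteq> (s(r := True)) v"
        using x(3)[of v] s[OF new[OF e(1)]] e by (cases "u = r") auto
    next
      fix u v w assume "{u, v} \<in> edges G" "u < v" "(v, w) \<in> {(r, x)}"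
      then show "(u, v) \<in> {(r, x)}" using r(2)[of u] ordered_graphD[OF G(1), of u v] by auto
    qed (use x rx in auto)
    then show ?thesis by blast
  qed
qed

text \<open>A sparse graph of minimum degree 2 is a disjoint union of cycles.\<close>

lemma near_proper_exists:
  assumes "ordered_graph G" "sparse G"
  shows "\<exists>s X. near_proper m G s X"
  using assms
proof (induction "card (verts G)" arbitrary: G rule: less_induct)
  case less
  note G = less.prems
  have fin: "finite (verts G)" using finite_verts[OF G(1)] .
  have IH: "\<exists>s X. near_proper m (induced G W) s X" if "W \<subset> verts G" for W
    using that less.hyps[of "induced G W"] psubset_card_mono[OF fin that]
      ordered_graph_induced[OF G(1)] sparse_induced[OF G(2)] by auto
  show ?case
  proof (cases "verts G = {}")
    case True
    then have "edges G = {}" using ordered_graph_edgeD[OF G(1)] by blast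
    then have "near_proper m G (\<lambda>_. True) {}" by (intro near_properI) auto
    then show ?thesis by blast
  next
    case ne: False
    show ?thesis
    proof (cases "\<exists>l\<in>verts G. degree G l \<le> 1")
      case True
      then obtain l where l: "l \<in> verts G" "degree G l \<le> 1" by blast
      then have "verts G - {l} \<subset> verts G" by blast
      then obtain s X where "near_proper m (induced G (verts G - {l})) s X" using IH by metis
      then show ?thesis by (rule near_proper_add_leaf[OF G(1) l])
    next
      case False
      then have deg: "2 \<le> degree G v" if "v \<in> verts G" for v using that by fastforce
      show ?thesis
      proof (cases "\<exists>A. A \<subseteq> verts G \<and> A \<noteq> {} \<and> A \<noteq> verts G \<and>
          (\<forall>u v. {u, v} \<in> edges G \<longrightarrow> u \<in> A \<longrightarrow> v \<in> A)")
        case True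
        then obtain A where A: "A \<subseteq> verts G" "A \<noteq> {}" "A \<noteq> verts G"
          and cl: "\<forall>u v. {u, v} \<in> edges G \<longrightarrow> u \<in> A \<longrightarrow> v \<in> A" by blast
        have "verts G \<inter> A \<subset> verts G" "verts G - A \<subset> verts G" using A by auto
        then obtain s X t Y where "near_proper m (induced G (verts G \<inter> A)) s X"
          "near_proper m (induced G (verts G - A)) t Y" using IH by metis
        then have "near_proper m G (\<lambda>v. if v \<in> A then s v else t v) (X \<union> Y)"
          using cl by (intro near_proper_disjoint_union[OF G(1)]) auto
        then show ?thesis by blast
      next
        case conn: False
        \<comment> \<open>All degrees are at least 2, while sparsity bounds their sum by twice the
          number of vertices.\<close>
        have "degree G v = 2" if v: "v \<in> verts G" for v
        proof (rule ccontr)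
          assume "degree G v \<noteq> 2"
          then have "2 < degree G v" using deg[OF v] by simp
          then have "(\<Sum>w\<in>verts G. 2) < (\<Sum>w\<in>verts G. degree G w)"
            using v deg fin by (intro sum_strict_mono_ex1) auto
          moreover have "card (edges G) \<le> card (verts G)"
            using G(2) spanned_verts[OF G(1)] unfolding sparse_def by (metis order_refl)
          ultimately show False using sum_degree[OF G(1)] by simp
        qed
        then show ?thesis using conn by (intro near_proper_cycle[OF G(1) ne]) auto
      qed
    qed
  qed
qed

section \<open>Blue graphs larger than a monotone path on three vertices\<close>

text \<open>An extra edge at a monotone path on three vertices creates a left star or one of the
  following three configurations. In a hook the vertices \<open>c\<close> and \<open>d\<close> may
  coincide, which covers the triangle.\<close>

definition has_fork :: "'a::linorder ograph \<Rightarrow> bool" where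
  "has_fork G \<longleftrightarrow> (\<exists>a b c d. a < b \<and> b < c \<and> b < d \<and> c \<noteq> d \<and>
     {a, b} \<in> edges G \<and> {b, c} \<in> edges G \<and> {b, d} \<in> edges G)"

definition has_hook :: "'a::linorder ograph \<Rightarrow> bool" where
  "has_hook G \<longleftrightarrow> (\<exists>a b c d. a < b \<and> b < c \<and> a < d \<and> b \<noteq> d \<and>
     {a, b} \<in> edges G \<and> {b, c} \<in> edges G \<and> {a, d} \<in> edges G)"

definition has_mono4 :: "'a::linorder ograph \<Rightarrow> bool" where
  "has_mono4 G \<longleftrightarrow> (\<exists>a b c d. a < b \<and> b < c \<and> c < d \<and>
     {a, b} \<in> edges G \<and> {b, c} \<in> edges G \<and> {c, d} \<in> edges G)"

lemma has_fork_embeds: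
  assumes "embeds H G" "ordered_graph H" "has_fork H"
  shows "has_fork G"
proof -
  obtain a b c d where h: "a < b" "b < c" "b < d" "c \<noteq> d"
    "{a, b} \<in> edges H" "{b, c} \<in> edges H" "{b, d} \<in> edges H"
    using assms(3) unfolding has_fork_def by blast
  have v: "a \<in> verts H" "b \<in> verts H" "c \<in> verts H" "d \<in> verts H"
    using ordered_graphD[OF assms(2)] h by auto
  show ?thesis using assms(1,2)
  proof (rule embedsE)
    fix p assume "\<And>u v. {u, v} \<in> edges H \<Longrightarrow> {p u, p v} \<in> edges G"
      "\<And>u v. u \<in> verts H \<Longrightarrow> v \<in> verts H \<Longrightarrow> p u < p v \<longleftrightarrow> u < v"
      "\<And>u v. u \<in> verts H \<Longrightarrow> v \<in> verts H \<Longrightarrow> p u = p v \<longleftrightarrow> u = v"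
    then show ?thesis unfolding has_fork_def using h v
      by (intro exI[of _ "p a"] exI[of _ "p b"] exI[of _ "p c"] exI[of _ "p d"]) auto
  qed
qed

lemma has_hook_embeds:
  assumes "embeds H G" "ordered_graph H" "has_hook H"
  shows "has_hook G"
proof -
  obtain a b c d where h: "a < b" "b < c" "a < d" "b \<noteq> d"
    "{a, b} \<in> edges H" "{b, c} \<in> edges H" "{a, d} \<in> edges H"
    using assms(3) unfolding has_hook_def by blast
  have v: "a \<in> verts H" "b \<in> verts H" "c \<in> verts H" "d \<in> verts H"
    using ordered_graphD[OF assms(2)] h by auto
  show ?thesis using assms(1,2)
  proof (rule embedsE)
    fix p assume "\<And>u v. {u, v} \<in> edges H \<Longrightarrow> {p u, p v} \<in> edges G"
      "\<And>u v. u \<in> verts H \<Longrightarrow> v \<in> verts H \<Longrightarrow> p u < p v \<longleftrightarrow> u < v"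
      "\<And>u v. u \<in> verts H \<Longrightarrow> v \<in> verts H \<Longrightarrow> p u = p v \<longleftrightarrow> u = v"
    then show ?thesis unfolding has_hook_def using h v
      by (intro exI[of _ "p a"] exI[of _ "p b"] exI[of _ "p c"] exI[of _ "p d"]) auto
  qed
qed

lemma has_mono4_embeds:
  assumes "embeds H G" "ordered_graph H" "has_mono4 H"
  shows "has_mono4 G"
proof -
  obtain a b c d where h: "a < b" "b < c" "c < d"
    "{a, b} \<in> edges H" "{b, c} \<in> edges H" "{c, d} \<in> edges H"
    using assms(3) unfolding has_mono4_def by blast
  have v: "a \<in> verts H" "b \<in> verts H" "c \<in> verts H" "d \<in> verts H"
    using ordered_graphD[OF assms(2)] h by auto
  show ?thesis using assms(1,2)
  proof (rule embedsE)
    fix p assume "\<And>u v. {u, v} \<in> edges H \<Longrightarrow> {p u, p v} \<in> edges G"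
      "\<And>u v. u \<in> verts H \<Longrightarrow> v \<in> verts H \<Longrightarrow> p u < p v \<longleftrightarrow> u < v"
      "\<And>u v. u \<in> verts H \<Longrightarrow> v \<in> verts H \<Longrightarrow> p u = p v \<longleftrightarrow> u = v"
    then show ?thesis unfolding has_mono4_def using h v
      by (intro exI[of _ "p a"] exI[of _ "p b"] exI[of _ "p c"] exI[of _ "p d"]) auto
  qed
qed

text \<open>Colour an edge by its smaller endpoint, except that the exceptional edges are blue. Then all
  blue paths \<open>a < b < c\<close> end with an exceptional edge.\<close>

lemma near_proper_edge_colouring:
  assumes F: "ordered_graph F" and np: "near_proper m F s X"
  defines "c \<equiv> \<lambda>e. if (Min e, Max e) \<notin> X \<and> s (Min e) then Red else Blue"
  shows "\<not> has_mono (colour_class F c Red)"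
    and "u < v \<Longrightarrow> {u, v} \<in> edges (colour_class F c Blue) \<Longrightarrow> s v"
    and "u < v \<Longrightarrow> {u, v} \<in> edges (colour_class F c Blue) \<Longrightarrow> s u \<Longrightarrow> (u, v) \<in> X"
proof -
  note np = near_properD[OF np]
  have c: "c {u, v} = Red \<longleftrightarrow> (u, v) \<notin> X \<and> s u" if "u < v" for u v
    using that by (simp add: c_def min_absorb1 max_absorb2)
  have blue: "(u, v) \<in> X \<or> \<not> s u" if "u < v" "{u, v} \<in> edges (colour_class F c Blue)" for u v
    using c[OF that(1)] that(2) by auto
  show "\<not> has_mono (colour_class F c Red)"
  proof
    assume "has_mono (colour_class F c Red)"
    then obtain u v w where h: "u < v" "v < w" "{u, v} \<in> edges F" "{v, w} \<in> edges F"
      "c {u, v} = Red" "c {v, w} = Red" unfolding has_mono_def by auto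
    then have "(u, v) \<notin> X" "s u" "s v" using c[OF h(1)] c[OF h(2)] by auto
    then show False using np(5)[OF h(3,1)] by simp
  qed
  show "s v" if "u < v" "{u, v} \<in> edges (colour_class F c Blue)" for u v
    using blue[OF that] np(4)[of u v] np(5)[of u v] that by auto
  show "(u, v) \<in> X" if "u < v" "{u, v} \<in> edges (colour_class F c Blue)" "s u" for u v
    using blue[OF that(1,2)] that(3) by simp
qed

text \<open>The second edge of a blue monotone path is exceptional. A fork thus has two exceptional
  edges starting at one vertex. In a hook, the choice of \<open>True\<close> for \<open>m\<close>
  makes the first edge exceptional as well; its lower end then has colour \<open>True\<close>, so
  the other blue edge going right from there is also exceptional, again two at one vertex.\<close>

lemma mono_fork_hook_avoidable:
  assumes F: "ordered_graph F" "sparse F"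
  obtains c where "\<not> has_mono (colour_class F c Red)" "\<not> has_fork (colour_class F c Blue)"
    "\<not> has_hook (colour_class F c Blue)"
proof -
  obtain s X where np: "near_proper True F s X" using near_proper_exists[OF F] by blast
  define c where "c = (\<lambda>e. if (Min e, Max e) \<notin> X \<and> s (Min e) then Red else Blue)"
  note col = near_proper_edge_colouring[OF F(1) np, folded c_def]
  note np = near_properD[OF np]
  have "\<not> has_fork (colour_class F c Blue)"
  proof
    assume "has_fork (colour_class F c Blue)"
    then obtain u v x y where h: "u < v" "v < x" "v < y" "x \<noteq> y"
      "{u, v} \<in> edges (colour_class F c Blue)" "{v, x} \<in> edges (colour_class F c Blue)"
      "{v, y} \<in> edges (colour_class F c Blue)" unfolding has_fork_def by blast
    have "s v" by (rule col(2)[OF h(1,5)])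
    then have "(v, x) \<in> X" "(v, y) \<in> X" using col(3) h by auto
    then show False using np(6)[of v x y] h(4) by simp
  qed
  moreover have "\<not> has_hook (colour_class F c Blue)"
  proof
    assume "has_hook (colour_class F c Blue)"
    then obtain u v x y where h: "u < v" "v < x" "u < y" "v \<noteq> y"
      "{u, v} \<in> edges (colour_class F c Blue)" "{v, x} \<in> edges (colour_class F c Blue)"
      "{u, y} \<in> edges (colour_class F c Blue)" unfolding has_hook_def by blast
    have "(v, x) \<in> X" by (rule col(3)[OF h(2,6) col(2)[OF h(1,5)]])
    then have uv: "(u, v) \<in> X" using np(7)[of u v x] h(1,5) by simp
    then have "(u, y) \<in> X" using col(3)[OF h(3,7)] np(3) by simp
    then show False using np(6)[OF uv] h(4) by simp
  qed
  ultimately show thesis using that col(1) by blast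
qed

text \<open>The second and third edges each conclude a blue monotone path on three vertices, so they
  would be consecutive exceptional edges, which the choice of \<open>False\<close> for
  \<open>m\<close> forbids.\<close>

lemma mono_mono4_avoidable:
  assumes F: "ordered_graph F" "sparse F"
  obtains c where "\<not> has_mono (colour_class F c Red)" "\<not> has_mono4 (colour_class F c Blue)"
proof -
  obtain s X where np: "near_proper False F s X" using near_proper_exists[OF F] by blast
  define c where "c = (\<lambda>e. if (Min e, Max e) \<notin> X \<and> s (Min e) then Red else Blue)"
  note col = near_proper_edge_colouring[OF F(1) np, folded c_def]
  note np = near_properD[OF np]
  have "\<not> has_mono4 (colour_class F c Blue)"
  proof
    assume "has_mono4 (colour_class F c Blue)"
    then obtain u v x y where h: "u < v" "v < x" "x < y"
      "{u, v} \<in> edges (colour_class F c Blue)" "{v, x} \<in> edges (colour_class F c Blue)"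
      "{x, y} \<in> edges (colour_class F c Blue)" unfolding has_mono4_def by blast
    have "(v, x) \<in> X" by (rule col(3)[OF h(2,5) col(2)[OF h(1,4)]])
    moreover have "(x, y) \<in> X" by (rule col(3)[OF h(3,6) col(2)[OF h(2,5)]])
    ultimately show False using np(8)[of v x y] by simp
  qed
  then show thesis using that col(1) by blast
qed

text \<open>Forests need no exceptional edges: the lower endpoints of the two edges of a monotone
  path are adjacent, hence coloured differently. This is why two monotone paths have no Ramsey
  forest.\<close>

lemma mono_mono_avoidable:
  fixes F :: "'a::linorder ograph"
  assumes F: "ordered_graph F" "strictly_sparse F"
  obtains c where "\<not> has_mono (colour_class F c Red)" "\<not> has_mono (colour_class F c Blue)"
proof -
  obtain s :: "'a \<Rightarrow> bool" where s: "\<And>u v. {u, v} \<in> edges F \<Longrightarrow> s u \<noteq> s v"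
    using proper_2_colouring[OF F] by blast
  define c where "c e = (if s (Min e) then Red else Blue)" for e
  have c: "c {u, v} = Red \<longleftrightarrow> s u" if "u < v" for u v using that by (simp add: c_def min_absorb1)
  have "\<not> has_mono (colour_class F c k)" for k
  proof
    assume "has_mono (colour_class F c k)"
    then obtain u v w where h: "u < v" "v < w" "{u, v} \<in> edges F"
      "c {u, v} = k" "c {v, w} = k" unfolding has_mono_def by auto
    then have "s u = s v" using c by metis
    then show False using s[OF h(3)] by simp
  qed
  then show thesis using that by blast
qed

section \<open>Graphs without left stars\<close>

lemma no_left_unique:
  assumes "\<not> has_left G" "{u, x} \<in> edges G" "{v, x} \<in> edges G" "u < x" "v < x"
  shows "u = v"
proof (rule ccontr)
  assume "u \<noteq> v"
  moreover have "{x, u} \<in> edges G" "{x, v} \<in> edges G" using assms(2,3) by (simp_all add: insert_commute)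
  ultimately show False using assms(1,4,5) unfolding has_left_def by blast
qed

text \<open>Each edge is charged to its larger endpoint. No vertex is charged twice, having at most
  one left neighbour, and the minimum of \<open>W\<close> is never charged.\<close>

lemma strictly_sparse_if_no_left:
  assumes G: "ordered_graph G" "\<not> has_left G"
  shows "strictly_sparse G"
  unfolding strictly_sparse_def
proof (intro allI impI)
  fix W assume W: "W \<subseteq> verts G" and ne: "W \<noteq> {}"
  have fin: "finite W" using W finite_verts[OF G(1)] finite_subset by blast
  have e: "\<exists>u v. e = {u, v} \<and> u < v \<and> u \<in> W \<and> v \<in> W \<and> {u, v} \<in> edges G" if e: "e \<in> spanned G W" for e
  proof -
    have eW: "e \<in> edges G" "e \<subseteq> W" using e by (auto simp: spanned_def)
    obtain u v where "e = {u, v}" "u < v" using ordered_graph_edgeD[OF G(1) eW(1)] by blast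
    then show ?thesis using eW by (intro exI[of _ u] exI[of _ v]) simp
  qed
  have "inj_on Max (spanned G W)"
  proof (rule inj_onI)
    fix d e assume de: "d \<in> spanned G W" "e \<in> spanned G W" "Max d = Max e"
    from e[OF de(1)] obtain u v where uv: "d = {u, v}" "u < v" "{u, v} \<in> edges G" by (elim exE conjE)
    from e[OF de(2)] obtain x y where xy: "e = {x, y}" "x < y" "{x, y} \<in> edges G" by (elim exE conjE)
    have v: "v = y" using de(3) uv(1,2) xy(1,2) by (simp add: max_absorb2)
    have "u = x" using no_left_unique[OF G(2) uv(3), of x] uv(2) xy(2,3) v by simp
    then show "d = e" using v uv(1) xy(1) by simp
  qed
  moreover have "Max ` spanned G W \<subseteq> W - {Min W}"
  proof
    fix x assume "x \<in> Max ` spanned G W"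
    then obtain d where d: "d \<in> spanned G W" "x = Max d" by (elim imageE)
    from e[OF d(1)] obtain u v where uv: "d = {u, v}" "u < v" "u \<in> W" "v \<in> W" by (elim exE conjE)
    have "x = v" using d(2) uv(1,2) by (simp add: max_absorb2)
    moreover have "Min W \<le> u" using fin uv(3) by simp
    ultimately show "x \<in> W - {Min W}" using uv(2,4) by simp
  qed
  ultimately have "card (spanned G W) \<le> card (W - {Min W})" using fin by (intro card_inj_on_le[of Max]) simp_all
  also have "\<dots> < card W" using fin ne by (intro card_Diff1_less) simp_all
  finally show "card (spanned G W) < card W" .
qed

section \<open>Ramsey forests for a star with leftmost center\<close>

text \<open>The position of \<open>v\<close> in \<open>V\<close>, counted from 0. It identifies a
  finite ordered vertex set with an initial segment of the naturals.\<close>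

definition rank :: "'a::linorder set \<Rightarrow> 'a \<Rightarrow> nat" where
  "rank V v = card {u \<in> V. u < v}"

lemma rank_less:
  assumes "finite V" "u \<in> V" "u < v"
  shows "rank V u < rank V v"
  unfolding rank_def using assms by (intro psubset_card_mono) auto

lemma rank_less_iff:
  assumes "finite V" "u \<in> V" "v \<in> V"
  shows "rank V u < rank V v \<longleftrightarrow> u < v"
  using rank_less[OF assms(1,2), of v] rank_less[OF assms(1,3), of u] by (cases u v rule: linorder_cases) auto

lemma rank_eq_iff:
  assumes "finite V" "u \<in> V" "v \<in> V"
  shows "rank V u = rank V v \<longleftrightarrow> u = v"
  using rank_less[OF assms(1,2), of v] rank_less[OF assms(1,3), of u] by (cases u v rule: linorder_cases) auto

lemma rank_less_card:
  assumes "finite V" "v \<in> V"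
  shows "rank V v < card V"
  unfolding rank_def using assms by (intro psubset_card_mono) auto

text \<open>The parent of a number is obtained by deleting its leading digit in base \<open>a + 1\<close>. So every
  number below \<open>(a + 1) ^ i\<close> has \<open>a\<close> children in each later block.\<close>

definition digit_tree :: "nat \<Rightarrow> nat \<Rightarrow> nat ograph" where
  "digit_tree a n = \<lparr>verts = {..<(a + 1) ^ n},
     edges = {{x mod (a + 1) ^ i, x} | i x. i < n \<and> (a + 1) ^ i \<le> x \<and> x < (a + 1) ^ (i + 1)}\<rparr>"

lemma digit_tree_verts [simp]: "verts (digit_tree a n) = {..<(a + 1) ^ n}"
  by (simp add: digit_tree_def)

text \<open>Adding \<open>j * (a + 1) ^ i\<close> puts the nonzero digit \<open>j\<close> in front
  of \<open>y\<close>, at position \<open>i\<close>; reduction modulo \<open>(a + 1) ^ i\<close>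
  removes it again.\<close>

lemma digit_tree_edgeI:
  assumes "i < n" "y < (a + 1) ^ i" "1 \<le> j" "j \<le> a"
  shows "{y, y + j * (a + 1) ^ i} \<in> edges (digit_tree a n)"
proof -
  let ?x = "y + j * (a + 1) ^ i"
  have "?x mod (a + 1) ^ i = y" using assms(2) by simp
  moreover have "(a + 1) ^ i \<le> ?x" using mult_le_mono1[OF assms(3), of "(a + 1) ^ i"] by linarith
  moreover have "?x < (a + 1) ^ (i + 1)"
  proof -
    have "?x < (a + 1) ^ i + a * (a + 1) ^ i"
      using assms(2) mult_le_mono1[OF assms(4), of "(a + 1) ^ i"] by linarith
    then show ?thesis by simp
  qed
  ultimately show ?thesis using assms(1) unfolding digit_tree_def ograph.simps mem_Collect_eq
    by (intro exI[of _ i] exI[of _ ?x]) simp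
qed

lemma digit_tree_edgeD:
  assumes "{u, x} \<in> edges (digit_tree a n)" "u < x"
  shows "\<exists>i<n. (a + 1) ^ i \<le> x \<and> x < (a + 1) ^ (i + 1) \<and> u = x mod (a + 1) ^ i"
proof -
  obtain i y where iy: "{u, x} = {y mod (a + 1) ^ i, y}" "i < n" "(a + 1) ^ i \<le> y" "y < (a + 1) ^ (i + 1)"
    using assms(1) unfolding digit_tree_def by auto
  have "y mod (a + 1) ^ i < y" using iy(3) by (metis add_gr_0 less_le_trans mod_less_divisor zero_less_one zero_less_power)
  then have "y = x" "y mod (a + 1) ^ i = u" using iy(1) assms(2) by (auto simp: doubleton_eq_iff)
  then show ?thesis using iy by auto
qed

lemma ordered_digit_tree: "ordered_graph (digit_tree a n)"
proof (rule ordered_graphI)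
  fix e assume "e \<in> edges (digit_tree a n)"
  then obtain i y where iy: "e = {y mod (a + 1) ^ i, y}" "i < n" "(a + 1) ^ i \<le> y" "y < (a + 1) ^ (i + 1)"
    unfolding digit_tree_def by auto
  have "y mod (a + 1) ^ i < y" using iy(3) by (metis add_gr_0 less_le_trans mod_less_divisor zero_less_one zero_less_power)
  moreover have "y < (a + 1) ^ n"
    using iy(2,4) power_increasing[of "i + 1" n "a + 1"] by linarith
  ultimately show "\<exists>u v. e = {u, v} \<and> u \<noteq> v \<and> u \<in> verts (digit_tree a n) \<and> v \<in> verts (digit_tree a n)"
    using iy(1) by (intro exI[of _ "y mod (a + 1) ^ i"] exI[of _ y]) auto
qed simp

text \<open>The position of the leading digit of \<open>x\<close> is unique, hence so is the smaller
  neighbour obtained by deleting that digit.\<close>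

lemma digit_tree_no_left:
  assumes "1 \<le> a"
  shows "\<not> has_left (digit_tree a n)"
proof
  assume "has_left (digit_tree a n)"
  then obtain x u v where "u < x" "v < x" "u \<noteq> v" "{x, u} \<in> edges (digit_tree a n)"
    "{x, v} \<in> edges (digit_tree a n)" unfolding has_left_def by blast
  then have h: "u < x" "v < x" "u \<noteq> v" "{u, x} \<in> edges (digit_tree a n)"
    "{v, x} \<in> edges (digit_tree a n)" by (simp_all add: insert_commute)
  obtain i where i: "(a + 1) ^ i \<le> x" "x < (a + 1) ^ (i + 1)" "u = x mod (a + 1) ^ i"
    using digit_tree_edgeD[OF h(4,1)] by blast
  obtain j where j: "(a + 1) ^ j \<le> x" "x < (a + 1) ^ (j + 1)" "v = x mod (a + 1) ^ j"
    using digit_tree_edgeD[OF h(5,2)] by blast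
  have "(a + 1) ^ i < (a + 1) ^ (j + 1)" "(a + 1) ^ j < (a + 1) ^ (i + 1)" using i j by linarith+
  then have "i < j + 1" "j < i + 1"
    using assms power_less_imp_less_exp[of "a + 1"] by (meson le_add2 le_imp_less_Suc less_add_one order_le_less_trans)+
  then have "i = j" by simp
  then show False using h(3) i(3) j(3) by simp
qed

text \<open>Without a red star, every vertex has a blue child in each later block. So
  \<open>H'\<close> can be embedded in blue greedily from left to right, each vertex becoming a blue
  child of the image of its left neighbour. Taking a new block for every vertex keeps the order
  correct.\<close>

lemma star_tree_ramsey:
  fixes H :: "'a::linorder ograph" and H' :: "'b::linorder ograph"
  assumes H: "ordered_graph H" and z: "z \<in> verts H" "\<And>v. v \<in> verts H \<Longrightarrow> z \<le> v"
    and star: "\<And>u v. {u, v} \<in> edges H \<Longrightarrow> u < v \<Longrightarrow> u = z"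
    and H': "ordered_graph H'" "\<not> has_left H'"
  shows "digit_tree (card (verts H)) (card (verts H')) \<in> ramsey_graphs H H'"
proof -
  define a n where "a = card (verts H)" and "n = card (verts H')"
  define b where "b = a + 1"
  have b: "1 \<le> b" by (simp add: b_def)
  let ?T = "digit_tree a n"
  let ?r = "rank (verts H)" and ?r' = "rank (verts H')"
  note fin = finite_verts[OF H] and fin' = finite_verts[OF H'(1)]
  define Q where "Q k j \<longleftrightarrow> (\<exists>u v. {u, v} \<in> edges H' \<and> u < v \<and> ?r' u = j \<and> ?r' v = k)" for k j
  have Q_less: "j < k" if Qkj: "Q k j" for k j
  proof -
    obtain u v where uv: "{u, v} \<in> edges H'" "u < v" "?r' u = j" "?r' v = k"
      using Qkj unfolding Q_def by blast
    then show ?thesis using rank_less[OF fin' ordered_graphD(1)[OF H'(1) uv(1)] uv(2)] by simp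
  qed
  have Q_unique: "i = j" if Qi: "Q k i" and Qj: "Q k j" for i j k
  proof -
    obtain u v where uv: "{u, v} \<in> edges H'" "u < v" "?r' u = i" "?r' v = k"
      using Qi unfolding Q_def by blast
    obtain x y where xy: "{x, y} \<in> edges H'" "x < y" "?r' x = j" "?r' y = k"
      using Qj unfolding Q_def by blast
    have "v = y" using rank_eq_iff[OF fin', of v y] uv xy ordered_graphD(2)[OF H'(1)] by simp
    then have "u = x" using no_left_unique[OF H'(2) uv(1)] uv xy by simp
    then show ?thesis using uv xy by simp
  qed
  \<comment> \<open>The parent in \<open>H'\<close>, in terms of ranks. A vertex without left
    neighbour gets the parent 0; the additional blue edge this produces does no harm, since
    embeddings need not reflect edges.\<close>
  define p where "p k = (if \<exists>j. Q k j then SOME j. Q k j else 0)" for k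
  have p: "p k = j" if "Q k j" for k j
    using that Q_unique[OF that] someI[of "Q k", OF that] unfolding p_def by auto
  have p_less: "p k < k" if "0 < k" for k
  proof (cases "\<exists>j. Q k j")
    case True
    then show ?thesis using p Q_less by blast
  qed (use that in \<open>simp add: p_def\<close>)
  have "embeds H (colour_class ?T c Red) \<or> embeds H' (colour_class ?T c Blue)" for c
  proof (rule disjCI)
    assume no_blue: "\<not> embeds H' (colour_class ?T c Blue)"
    show "embeds H (colour_class ?T c Red)"
    proof (rule ccontr)
      assume no_red: "\<not> embeds H (colour_class ?T c Red)"
      have child: "\<exists>j. 1 \<le> j \<and> j \<le> a \<and> c {y, y + j * b ^ i} = Blue" if i: "i < n" and y: "y < b ^ i" for i y
      proof (rule ccontr)
        assume *: "\<not> ?thesis"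
        have red: "c {y, y + j * b ^ i} = Red" if j: "1 \<le> j" "j \<le> a" for j
        proof (cases "c {y, y + j * b ^ i}")
          case Blue
          then show ?thesis using * j by blast
        qed
        \<comment> \<open>The center has rank 0 and goes to \<open>y\<close>; every other vertex
          goes to the child of \<open>y\<close> whose leading digit is its rank, a number between 1
          and \<open>a\<close>.\<close>
        define q where "q v = y + ?r v * b ^ i" for v
        have bi: "0 < b ^ i" using b by simp
        have ra: "?r v \<le> a" if "v \<in> verts H" for v
          using rank_less_card[OF fin that] by (simp add: a_def)
        have none: "{u \<in> verts H. u < z} = {}" using z(2) by force
        have r0: "?r z = 0" unfolding rank_def none by simp
        have edge: "{q z, q v} \<in> edges (colour_class ?T c Red)" if e: "{z, v} \<in> edges H" "z < v" for v
        proof -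
          have "v \<in> verts H" using ordered_graphD[OF H e(1)] by blast
          then have "1 \<le> ?r v" "?r v \<le> a" using rank_less[OF fin z(1) e(2)] ra by simp_all
          then show ?thesis
            using digit_tree_edgeI[of i n y a "?r v"] i y red[of "?r v"] r0 by (simp add: q_def b_def)
        qed
        have "embeds H (colour_class ?T c Red)" unfolding embeds_def
        proof (intro exI[of _ q] conjI allI impI)
          show "strict_mono_on (verts H) q"
          proof (rule strict_mono_onI)
            fix u v assume "u \<in> verts H" "u < v"
            then have "?r u < ?r v" using rank_less[OF fin] by blast
            then show "q u < q v" using bi by (simp add: q_def)
          qed
          show "q ` verts H \<subseteq> verts (colour_class ?T c Red)"
          proof
            fix x assume "x \<in> q ` verts H"
            then obtain v where v: "v \<in> verts H" "x = q v" by blast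
            have "q v < b ^ i + a * b ^ i"
              using y mult_le_mono1[OF ra[OF v(1)], of "b ^ i"] unfolding q_def by linarith
            also have "\<dots> = b ^ (i + 1)" by (simp add: b_def)
            also have "\<dots> \<le> b ^ n" using i b by (intro power_increasing) auto
            finally show "x \<in> verts (colour_class ?T c Red)" using v by (simp add: b_def)
          qed
          fix u v assume e: "{u, v} \<in> edges H"
          consider "u < v" | "v < u" using ordered_graphD(3)[OF H e] by (cases u v rule: linorder_cases) auto
          then show "{q u, q v} \<in> edges (colour_class ?T c Red)"
          proof cases
            case 1
            then show ?thesis using star[OF e] e edge by simp
          next
            case 2
            have e': "{v, u} \<in> edges H" using e by (simp add: insert_commute)
            then have "{q v, q u} \<in> edges (colour_class ?T c Red)" using star[OF e' 2] edge 2 by simp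
            then show ?thesis by (simp add: insert_commute)
          qed
        qed
        then show False using no_red by blast
      qed
      \<comment> \<open>The image of rank \<open>k\<close> has its leading digit in position
        \<open>k - 1\<close>, and for \<open>k = 0\<close> the bound forces the image 0. These
        blocks are consecutive intervals, which later yields monotonicity.\<close>
      define ok where "ok x k \<longleftrightarrow> x k < b ^ k \<and> (0 < k \<longrightarrow> b ^ (k - 1) \<le> x k \<and>
        {x (p k), x k} \<in> edges (colour_class ?T c Blue))" for x :: "nat \<Rightarrow> nat" and k
      have "\<exists>x. \<forall>k<m. ok x k" if "m \<le> n" for m
        using that
      proof (induction m)
        case (Suc m)
        then obtain x where x: "\<And>k. k < m \<Longrightarrow> ok x k" by auto
        obtain w where w: "w < b ^ m" "0 < m \<longrightarrow> b ^ (m - 1) \<le> w \<and>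
          {x (p m), w} \<in> edges (colour_class ?T c Blue)"
        proof (cases "m = 0")
          case True
          then show thesis using that[of 0] by simp
        next
          case False
          then obtain i where i: "m = Suc i" by (cases m) auto
          have pm: "p m < m" using p_less False by simp
          then have "x (p m) < b ^ p m" using x unfolding ok_def by blast
          also have "\<dots> \<le> b ^ i" using pm i b by (intro power_increasing) auto
          finally have y: "x (p m) < b ^ i" .
          obtain j where j: "1 \<le> j" "j \<le> a" "c {x (p m), x (p m) + j * b ^ i} = Blue"
            using child[of i "x (p m)"] y i Suc.prems by auto
          let ?w = "x (p m) + j * b ^ i"
          have "?w < b ^ i + a * b ^ i"
            using y mult_le_mono1[OF j(2), of "b ^ i"] by linarith
          then have "?w < b ^ m" by (simp add: b_def i)
          moreover have "b ^ (m - 1) \<le> ?w" using mult_le_mono1[OF j(1), of "b ^ i"] i by (simp only: diff_Suc_1)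
          moreover have "{x (p m), ?w} \<in> edges (colour_class ?T c Blue)"
            using digit_tree_edgeI[of i n "x (p m)" a j] y j i Suc.prems by (simp add: b_def)
          ultimately show thesis using that by blast
        qed
        have "ok (x(m := w)) k" if k: "k < Suc m" for k
        proof (cases "k = m")
          case True
          then show ?thesis using w p_less[of m] by (auto simp: ok_def)
        next
          case False
          then have "ok x k" "k < m" using x k by auto
          moreover then have "p k \<noteq> m \<or> k = 0" using p_less[of k] by (cases "k = 0") auto
          ultimately show ?thesis by (auto simp: ok_def)
        qed
        then show ?case by blast
      qed simp
      then obtain x where ok: "\<And>k. k < n \<Longrightarrow> ok x k" by blast
      have mono: "x k < x l" if "k < l" "l < n" for k l
      proof -
        have "x k < b ^ k" using ok[of k] that unfolding ok_def by simp
        also have "b ^ k \<le> b ^ (l - 1)" using b that by (intro power_increasing) auto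
        also have "\<dots> \<le> x l" using ok[OF that(2)] that(1) unfolding ok_def by simp
        finally show ?thesis .
      qed
      have rn: "?r' v < n" if "v \<in> verts H'" for v
        using rank_less_card[OF fin' that] by (simp add: n_def)
      have edge: "{x (?r' u), x (?r' v)} \<in> edges (colour_class ?T c Blue)"
        if e: "{u, v} \<in> edges H'" "u < v" for u v
      proof -
        have "Q (?r' v) (?r' u)" using e unfolding Q_def by blast
        then have "p (?r' v) = ?r' u" "0 < ?r' v" using p Q_less by fastforce+
        then show ?thesis using ok[OF rn[OF ordered_graphD(2)[OF H'(1) e(1)]]] unfolding ok_def by simp
      qed
      have "embeds H' (colour_class ?T c Blue)" unfolding embeds_def
      proof (intro exI[of _ "\<lambda>v. x (?r' v)"] conjI allI impI)
        show "strict_mono_on (verts H') (\<lambda>v. x (?r' v))"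
        proof (rule strict_mono_onI)
          fix u v assume "u \<in> verts H'" "v \<in> verts H'" "u < v"
          then show "x (?r' u) < x (?r' v)" using rank_less[OF fin'] rn mono by blast
        qed
        show "(\<lambda>v. x (?r' v)) ` verts H' \<subseteq> verts (colour_class ?T c Blue)"
        proof
          fix w assume "w \<in> (\<lambda>v. x (?r' v)) ` verts H'"
          then obtain v where v: "v \<in> verts H'" "w = x (?r' v)" by blast
          have "w < b ^ ?r' v" using ok[OF rn[OF v(1)]] v(2) unfolding ok_def by simp
          also have "\<dots> \<le> b ^ n" using rn[OF v(1)] b by (intro power_increasing) auto
          finally show "w \<in> verts (colour_class ?T c Blue)" by (simp add: b_def)
        qed
        fix u v assume e: "{u, v} \<in> edges H'"
        consider "u < v" | "v < u" using ordered_graphD(3)[OF H'(1) e] by (cases u v rule: linorder_cases) auto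
        then show "{x (?r' u), x (?r' v)} \<in> edges (colour_class ?T c Blue)"
        proof cases
          case 1
          then show ?thesis using edge e by blast
        next
          case 2
          have "{x (?r' v), x (?r' u)} \<in> edges (colour_class ?T c Blue)"
            using edge[of v u] e 2 by (simp only: insert_commute)
          then show ?thesis by (simp only: insert_commute)
        qed
      qed
      then show False using no_blue by blast
    qed
  qed
  then show ?thesis using ordered_digit_tree ramsey_graphs_iff[OF H H'(1)] unfolding a_def n_def by blast
qed

section \<open>Connected graphs determined by their paths on three vertices\<close>

text \<open>Let \<open>z\<close> be the lower end of an edge. A left neighbour of \<open>z\<close>
  would give a monotone path, and a further edge at a right neighbour of \<open>z\<close> would give
  a monotone path or a left star. So \<open>z\<close> and its right neighbours are closed under
  adjacency.\<close>

lemma star_center: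
  assumes G: "ordered_graph G" "connected_graph G" "edges G \<noteq> {}"
    and no: "\<not> has_left G" "\<not> has_mono G"
  shows "\<exists>z\<in>verts G. (\<forall>v\<in>verts G. z \<le> v) \<and> (\<forall>u v. {u, v} \<in> edges G \<longrightarrow> u < v \<longrightarrow> u = z)"
proof -
  obtain z w where zw: "{z, w} \<in> edges G" "z < w" "z \<in> verts G"
    using G(1,3) ordered_graph_edgeD by blast
  have nm: "\<not> (u < v \<and> v < x)" if "{u, v} \<in> edges G" "{v, x} \<in> edges G" for u v x
    using no(2) that unfolding has_mono_def by blast
  define A where "A = insert z {v. z < v \<and> {z, v} \<in> edges G}"
  have "verts G \<subseteq> A"
  proof (rule connected_graph_closed[OF G(2) _ zw(3)])
    show "z \<in> A" by (simp add: A_def)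
    fix x y assume e: "{x, y} \<in> edges G" and x: "x \<in> A"
    have e': "{y, x} \<in> edges G" using e by (simp add: insert_commute)
    have xy: "x \<noteq> y" using ordered_graphD(3)[OF G(1) e] .
    show "y \<in> A"
    proof (cases "x = z")
      case True
      then have "\<not> y < z" using nm[of y z w] e' zw by auto
      then show ?thesis using True e xy by (auto simp: A_def)
    next
      case False
      then have zx: "z < x" "{z, x} \<in> edges G" using x by (auto simp: A_def)
      then have "y < x" using nm[OF zx(2) e] xy by auto
      then have "y = z" using no_left_unique[OF no(1) e' zx(2)] zx by simp
      then show ?thesis by (simp add: A_def)
    qed
  qed
  then have V: "z = v \<or> z < v \<and> {z, v} \<in> edges G" if "v \<in> verts G" for v
    using that by (auto simp: A_def)
  have "u = z" if e: "{u, v} \<in> edges G" "u < v" for u v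
    using V[OF ordered_graphD(1)[OF G(1) e(1)]] nm[of z u v] e by auto
  moreover have "z \<le> v" if "v \<in> verts G" for v using V[OF that] by auto
  ultimately show ?thesis using zw(3) by blast
qed

lemma three_path_cases:
  assumes "ordered_graph G" "{a, b} \<in> edges G" "{a, c} \<in> edges G" "b \<noteq> c"
  shows "has_right G \<or> has_left G \<or> has_mono G"
proof -
  have "a \<noteq> b" "a \<noteq> c" using ordered_graphD(3)[OF assms(1)] assms(2,3) by auto
  moreover have "{b, a} \<in> edges G" "{c, a} \<in> edges G" using assms(2,3) by (simp_all add: insert_commute)
  ultimately show ?thesis
    using assms unfolding has_right_def has_left_def has_mono_def by (meson neqE)
qed

text \<open>A further neighbour at either end of an edge would make that end the middle of a path on
  three vertices.\<close>

lemma is_K2_or_three_path: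
  assumes G: "ordered_graph G" "connected_graph G" "edges G \<noteq> {}"
  shows "is_K2 G \<or> has_right G \<or> has_left G \<or> has_mono G"
proof (rule disjCI)
  assume no: "\<not> (has_right G \<or> has_left G \<or> has_mono G)"
  obtain u v where uv: "{u, v} \<in> edges G" "u < v" "u \<in> verts G" "v \<in> verts G"
    using G(1,3) ordered_graph_edgeD by blast
  have vu: "{v, u} \<in> edges G" using uv(1) by (simp add: insert_commute)
  have nb: "y \<in> {u, v} - {x}" if e: "{x, y} \<in> edges G" and x: "x \<in> {u, v}" for x y
  proof (cases "x = u")
    case True
    then show ?thesis using three_path_cases[OF G(1) uv(1), of y] e no uv(2) by auto
  next
    case False
    then show ?thesis using three_path_cases[OF G(1) vu, of y] e no uv(2) x by auto
  qed
  have "verts G \<subseteq> {u, v}"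
    by (rule connected_graph_closed[OF G(2) _ uv(3)]) (use nb in blast)+
  then have V: "verts G = {u, v}" using uv by auto
  have "edges G \<subseteq> {{u, v}}"
  proof
    fix e assume "e \<in> edges G"
    then obtain x y where "e = {x, y}" "x < y" "x \<in> verts G" "y \<in> verts G"
      using ordered_graph_edgeD[OF G(1)] by blast
    then show "e \<in> {{u, v}}" using V uv(2) by auto
  qed
  then have "edges G = {{u, v}}" using uv(1) by auto
  then have "G = \<lparr>verts = {u, v}, edges = {{u, v}}\<rparr>" using V by (cases G) simp
  then show "is_K2 G" using uv(2) unfolding is_K2_def by (intro exI[of _ u] exI[of _ v]) simp
qed

text \<open>Extra edges are impossible at each vertex of \<open>a < b < c\<close>: at
  \<open>a\<close> they give a hook or a four-vertex path, at \<open>b\<close> a fork or a left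
  star, at \<open>c\<close> a four-vertex path or a left star. Connectivity then leaves no other
  vertices.\<close>

lemma monotone_P3_if:
  assumes G: "ordered_graph G" "connected_graph G" "has_mono G"
    and no: "\<not> has_left G" "\<not> has_fork G" "\<not> has_hook G" "\<not> has_mono4 G"
  shows "monotone_P3 G"
proof -
  obtain a b c where h: "a < b" "b < c" "{a, b} \<in> edges G" "{b, c} \<in> edges G"
    using G(3) unfolding has_mono_def by blast
  have va: "a \<in> verts G" "b \<in> verts G" "c \<in> verts G" using ordered_graphD[OF G(1)] h by auto
  have n4: "\<not> (x < y \<and> y < u \<and> u < v)"
    if "{x, y} \<in> edges G" "{y, u} \<in> edges G" "{u, v} \<in> edges G" for x y u v
    using no(4) that unfolding has_mono4_def by blast
  have a: "y = b" if e: "{a, y} \<in> edges G" for y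
  proof (rule ccontr)
    assume "y \<noteq> b"
    have "\<not> a < y" using no(3) h e \<open>y \<noteq> b\<close> unfolding has_hook_def by metis
    then have "y < a" using ordered_graphD(3)[OF G(1) e] by simp
    then show False using n4[of y a b c] h e by (simp add: insert_commute)
  qed
  have b: "y = a \<or> y = c" if e: "{b, y} \<in> edges G" for y
  proof (rule ccontr)
    assume y: "\<not> ?thesis"
    have "\<not> b < y" using no(2) h e y unfolding has_fork_def by metis
    then have "y < b" using ordered_graphD(3)[OF G(1) e] by simp
    moreover have "{y, b} \<in> edges G" using e by (simp add: insert_commute)
    ultimately show False using no_left_unique[OF no(1) h(3), of y] h(1) y by simp
  qed
  have c: "y = b" if e: "{c, y} \<in> edges G" for y
  proof (rule ccontr)
    assume y: "y \<noteq> b"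
    have "\<not> c < y" using n4[OF h(3,4) e] h by simp
    then have "y < c" using ordered_graphD(3)[OF G(1) e] by simp
    moreover have "{y, c} \<in> edges G" using e by (simp add: insert_commute)
    ultimately show False using no_left_unique[OF no(1) h(4), of y] h(2) y by simp
  qed
  have "verts G \<subseteq> {a, b, c}"
    by (rule connected_graph_closed[OF G(2) _ va(1)]) (use a b c in blast)+
  then have V: "verts G = {a, b, c}" using va by auto
  have "edges G \<subseteq> {{a, b}, {b, c}}"
  proof
    fix e assume "e \<in> edges G"
    then obtain x y where e: "e = {x, y}" "{x, y} \<in> edges G" "x \<in> verts G"
      using ordered_graph_edgeD[OF G(1)] by blast
    then consider "x = a" | "x = b" | "x = c" using V by blast
    then show "e \<in> {{a, b}, {b, c}}" using a[of y] b[of y] c[of y] e by cases (auto simp: insert_commute)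
  qed
  then have "edges G = {{a, b}, {b, c}}" using h by auto
  then have "G = \<lparr>verts = {a, b, c}, edges = {{a, b}, {b, c}}\<rparr>" using V by (cases G) simp
  then show ?thesis using h(1,2) unfolding monotone_P3_def
    by (intro exI[of _ a] exI[of _ b] exI[of _ c]) simp
qed

section \<open>Cycles\<close>

lemma cycle_not_strictly_sparse:
  assumes G: "ordered_graph G" "contains_cycle G"
  shows "\<not> strictly_sparse G"
proof -
  obtain xs where xs: "3 \<le> length xs" "distinct xs" "set xs \<subseteq> verts G"
    and e: "\<And>i. i < length xs \<Longrightarrow> {xs ! i, xs ! (Suc i mod length xs)} \<in> edges G"
    using G(2) unfolding contains_cycle_def by blast
  define n where "n = length xs"
  have n: "3 \<le> n" using xs(1) by (simp add: n_def)
  define f where "f i = {xs ! i, xs ! (Suc i mod n)}" for i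
  have "inj_on f {..<n}"
  proof (rule inj_onI)
    fix i j assume ij: "i \<in> {..<n}" "j \<in> {..<n}" "f i = f j"
    have lt: "Suc i mod n < n" "Suc j mod n < n" using n by simp_all
    have nth: "xs ! a = xs ! b \<longleftrightarrow> a = b" if "a < n" "b < n" for a b
      using that xs(2) nth_eq_iff_index_eq by (simp add: n_def)
    have "i = j \<or> (i = Suc j mod n \<and> Suc i mod n = j)"
      using ij lt nth unfolding f_def by (auto simp: doubleton_eq_iff)
    \<comment> \<open>Two different cyclic positions that succeed each other would force
      \<open>n\<close> to be at most 2.\<close>
    moreover have False if *: "i = Suc j mod n" "Suc i mod n = j" "i \<noteq> j"
    proof -
      have "Suc (Suc j mod n) mod n = j mod n" using * ij by simp
      then have "Suc (Suc j) mod n = j mod n" by (simp add: mod_Suc_eq)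
      moreover have "j < n" using ij by simp
      ultimately show False using n by (auto simp: mod_Suc split: if_splits)
    qed
    ultimately show "i = j" by blast
  qed
  moreover have "f ` {..<n} \<subseteq> spanned G (set xs)"
  proof
    fix d assume "d \<in> f ` {..<n}"
    then obtain i where i: "i < n" "d = f i" by blast
    have "Suc i mod n < n" using n by simp
    then have "f i \<subseteq> set xs" using i(1) by (simp add: f_def n_def)
    then show "d \<in> spanned G (set xs)" using e[of i] i by (simp add: spanned_def f_def n_def)
  qed
  ultimately have "n \<le> card (spanned G (set xs))"
    using card_inj_on_le[of f "{..<n}"] finite_spanned[OF G(1)] by fastforce
  moreover have "card (set xs) = n" using xs(2) by (simp add: distinct_card n_def)
  moreover have "set xs \<noteq> {}" using n by (auto simp: n_def)
  ultimately show ?thesis using xs(3) unfolding strictly_sparse_def by (metis not_le)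
qed

text \<open>A minimal set violating strict sparsity has minimum degree at least 2. Close up a longest path
  inside it.\<close>

lemma contains_cycle_if_not_strictly_sparse:
  assumes G: "ordered_graph G" "\<not> strictly_sparse G"
  shows "contains_cycle G"
proof -
  define bad where "bad W \<longleftrightarrow> W \<subseteq> verts G \<and> W \<noteq> {} \<and> card W \<le> card (spanned G W)" for W
  obtain W0 where W0: "bad W0"
    using G(2) unfolding strictly_sparse_def bad_def by (meson not_le)
  obtain W where W: "bad W" and minimal: "\<And>U. bad U \<Longrightarrow> card W \<le> card U"
    using ex_has_least_nat[of bad W0 card] W0 by blast
  have WV: "W \<subseteq> verts G" and ne: "W \<noteq> {}" using W by (auto simp: bad_def)
  have fin: "finite W" using WV finite_verts[OF G(1)] finite_subset by blast
  let ?G = "induced G W"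
  have oG: "ordered_graph ?G" by (rule ordered_graph_induced[OF G(1) WV])
  \<comment> \<open>Deleting a vertex of degree at most 1 loses at most one edge, so the rest would
    be a smaller violating set. It is nonempty because a single vertex spans no edge.\<close>
  have deg: "2 \<le> degree ?G v" if v: "v \<in> W" for v
  proof (rule ccontr)
    assume "\<not> ?thesis"
    then have d: "degree ?G v \<le> 1" by simp
    have "spanned G W = spanned G (W - {v}) \<union> {e \<in> edges ?G. v \<in> e}" by (auto simp: spanned_def)
    then have "card (spanned G W) \<le> card (spanned G (W - {v})) + degree ?G v"
      unfolding degree_def by (metis card_Un_le)
    then have le: "card (W - {v}) \<le> card (spanned G (W - {v}))"
      using W d card_Diff_singleton[OF v] unfolding bad_def by linarith
    have "W - {v} \<noteq> {}"
    proof
      assume "W - {v} = {}"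
      then have "W = {v}" using v by blast
      then have "edges ?G = {}" using ordered_graph_edgeD[OF oG] by fastforce
      then show False using W fin ne by (simp add: bad_def)
    qed
    then have "bad (W - {v})" using WV le by (auto simp: bad_def)
    then show False using minimal[of "W - {v}"] card_Diff1_less[OF fin v] by simp
  qed
  define path where "path xs \<longleftrightarrow> xs \<noteq> [] \<and> distinct xs \<and> set xs \<subseteq> W \<and>
    (\<forall>i. Suc i < length xs \<longrightarrow> {xs ! i, xs ! Suc i} \<in> edges G)" for xs
  obtain w where "w \<in> W" using ne by blast
  then have "path [w]" by (simp add: path_def)
  moreover have "length xs < Suc (card W)" if "path xs" for xs
    using that card_mono[OF fin, of "set xs"] by (simp add: path_def distinct_card)
  ultimately obtain xs where xs: "path xs" and longest: "\<And>ys. path ys \<Longrightarrow> length ys \<le> length xs"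
    using ex_has_greatest_nat[of path "[w]" length "Suc (card W)"] by blast
  define x where "x = xs ! 0"
  have xW: "x \<in> W" using xs unfolding path_def x_def by (metis length_greater_0_conv nth_mem subsetD)
  obtain y z where yz: "y \<noteq> z" "{x, y} \<in> edges ?G" "{x, z} \<in> edges ?G"
    using degree_ge_2_neighbours[OF oG deg[OF xW]] by blast
  \<comment> \<open>A neighbour of the first vertex outside the path could be put in front of it,
    making it longer.\<close>
  have on_path: "\<exists>j<length xs. 1 \<le> j \<and> xs ! j = v" if v: "{x, v} \<in> edges ?G" for v
  proof -
    have vW: "v \<in> W" "x \<noteq> v" "{x, v} \<in> edges G"
      using ordered_graphD[OF oG v] v by (auto simp: spanned_def)
    have "v \<in> set xs"
    proof (rule ccontr)
      assume "v \<notin> set xs"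
      moreover have "{(v # xs) ! i, (v # xs) ! Suc i} \<in> edges G" if "Suc i < length (v # xs)" for i
        using that xs vW(3) by (cases i) (auto simp: path_def x_def insert_commute)
      ultimately have "path (v # xs)" using xs vW(1) by (simp add: path_def)
      then show False using longest[of "v # xs"] by simp
    qed
    then obtain j where j: "j < length xs" "xs ! j = v" by (auto simp: in_set_conv_nth)
    moreover have "j \<noteq> 0" using j vW(2) unfolding x_def by metis
    ultimately show ?thesis by (intro exI[of _ j]) simp
  qed
  obtain j k where jk: "j < length xs" "1 \<le> j" "xs ! j = y" "k < length xs" "1 \<le> k" "xs ! k = z"
    using on_path[OF yz(2)] on_path[OF yz(3)] by blast
  \<comment> \<open>Two distinct neighbours of \<open>x\<close> sit at different positions from 1
    on, so the farther one is at position 2 or later, and the prefix ending there closes up to a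
    cycle with at least three vertices.\<close>
  define m where "m = max j k"
  have "j \<noteq> k" using jk yz(1) by auto
  then have m: "2 \<le> m" "m < length xs" "{xs ! m, x} \<in> edges G"
    using jk yz by (auto simp: m_def max_def spanned_def insert_commute)
  let ?c = "take (Suc m) xs"
  have len: "length ?c = Suc m" using m(2) by simp
  have "{?c ! i, ?c ! (Suc i mod length ?c)} \<in> edges G" if "i < length ?c" for i
  proof (cases "i = m")
    case True
    then show ?thesis using m len by (simp add: x_def)
  next
    case False
    then have "i < m" using that len by simp
    then have "Suc i mod length ?c = Suc i" "?c ! i = xs ! i" "?c ! Suc i = xs ! Suc i" "Suc i < length xs"
      using len m(2) by simp_all
    then show ?thesis using xs unfolding path_def by metis
  qed
  moreover have "distinct ?c" "set ?c \<subseteq> verts G"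
    using xs WV set_take_subset[of "Suc m" xs] unfolding path_def by auto
  ultimately show ?thesis using m(1) len unfolding contains_cycle_def by (intro exI[of _ ?c]) simp
qed

section \<open>Order reversal\<close>

text \<open>Reversal is a map into another linear order, not a dual order on the same type, so that
  a reversed host can again be a graph on the naturals.\<close>

definition reverses :: "('a::linorder \<Rightarrow> 'b::linorder) \<Rightarrow> 'a set \<Rightarrow> bool" where
  "reverses f V \<longleftrightarrow> (\<forall>u\<in>V. \<forall>v\<in>V. u < v \<longrightarrow> f v < f u)"

lemma reverses_less_iff:
  assumes "reverses f V" "u \<in> V" "v \<in> V"
  shows "f v < f u \<longleftrightarrow> u < v"
proof -
  have "u < v \<Longrightarrow> f v < f u" "v < u \<Longrightarrow> f u < f v" using assms by (simp_all add: reverses_def)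
  then show ?thesis by (cases u v rule: linorder_cases) auto
qed

lemma reverses_inj:
  assumes "reverses f V"
  shows "inj_on f V"
proof (rule inj_onI)
  fix u v assume "u \<in> V" "v \<in> V" "f u = f v"
  then show "u = v"
    using reverses_less_iff[OF assms, of u v] reverses_less_iff[OF assms, of v u]
    by (cases u v rule: linorder_cases) auto
qed

lemma reverses_inv:
  assumes "reverses f V"
  shows "reverses (inv_into V f) (f ` V)"
  unfolding reverses_def
proof (intro ballI impI)
  fix x y assume "x \<in> f ` V" "y \<in> f ` V" and xy: "x < y"
  then obtain u v where "u \<in> V" "x = f u" "v \<in> V" "y = f v" by blast
  then show "inv_into V f y < inv_into V f x"
    using xy reverses_inj[OF assms] reverses_less_iff[OF assms, of v u] by simp
qed

lemma reverses_exists: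
  assumes "finite V"
  shows "\<exists>f :: 'a::linorder \<Rightarrow> nat. reverses f V"
proof -
  have "card {u \<in> V. y < u} < card {u \<in> V. x < u}" if "x \<in> V" "y \<in> V" "x < y" for x y :: 'a
    using assms that by (intro psubset_card_mono) auto
  then show ?thesis unfolding reverses_def by (intro exI[of _ "\<lambda>v. card {u \<in> V. v < u}"]) blast
qed

text \<open>An embedding conjugated by two reversals preserves the order; the colouring of the
  reversed host is pulled back along \<open>g\<close>.\<close>

lemma embeds_reverse:
  assumes H: "ordered_graph H" "reverses f (verts H)" and F: "ordered_graph F" "reverses g (verts F)"
    and emb: "embeds H (colour_class F (\<lambda>e. c (g ` e)) k)"
  shows "embeds (relabel f H) (colour_class (relabel g F) c k)"
proof -
  obtain p where p: "strict_mono_on (verts H) p" "p ` verts H \<subseteq> verts F"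
    and e: "\<And>u v. {u, v} \<in> edges H \<Longrightarrow> {p u, p v} \<in> edges F \<and> c (g ` {p u, p v}) = k"
    using emb unfolding embeds_def by auto
  define h where "h = inv_into (verts H) f"
  have h: "h (f v) = v" if "v \<in> verts H" for v
    using that reverses_inj[OF H(2)] by (simp add: h_def)
  show ?thesis unfolding embeds_def
  proof (intro exI[of _ "\<lambda>x. g (p (h x))"] conjI allI impI)
    show "strict_mono_on (verts (relabel f H)) (\<lambda>x. g (p (h x)))"
    proof (rule strict_mono_onI)
      fix x y assume "x \<in> verts (relabel f H)" "y \<in> verts (relabel f H)" and xy: "x < y"
      then obtain u v where uv: "u \<in> verts H" "x = f u" "v \<in> verts H" "y = f v" by auto
      then have "v < u" using xy reverses_less_iff[OF H(2)] by blast
      then have "p v < p u" using strict_mono_onD[OF p(1)] uv by blast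
      moreover have "p u \<in> verts F" "p v \<in> verts F" using p(2) uv by auto
      ultimately show "g (p (h x)) < g (p (h y))" using uv h reverses_less_iff[OF F(2)] by simp
    qed
    show "(\<lambda>x. g (p (h x))) ` verts (relabel f H) \<subseteq> verts (colour_class (relabel g F) c k)"
      using p(2) h by auto
    fix x y assume "{x, y} \<in> edges (relabel f H)"
    then obtain d where d: "d \<in> edges H" "{x, y} = f ` d" by auto
    obtain u v where uv: "d = {u, v}" "u \<in> verts H" "v \<in> verts H"
      using ordered_graph_edgeD[OF H(1) d(1)] by blast
    have uv': "{u, v} \<in> edges H" using d(1) uv(1) by simp
    have vu: "{v, u} \<in> edges H" using uv' by (simp add: insert_commute)
    have img: "{g (p a), g (p b)} \<in> edges (colour_class (relabel g F) c k)" if "{a, b} \<in> edges H" for a b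
    proof -
      have "g ` {p a, p b} \<in> (`) g ` edges F" using e[OF that] by blast
      then show ?thesis using e[OF that] by simp
    qed
    have "x = f u \<and> y = f v \<or> x = f v \<and> y = f u" using d(2) uv(1) by (auto simp: doubleton_eq_iff)
    then show "{g (p (h x)), g (p (h y))} \<in> edges (colour_class (relabel g F) c k)"
      using img[OF uv'] img[OF vu] h[OF uv(2)] h[OF uv(3)] by (elim disjE) simp_all
  qed
qed

lemma ramsey_graphs_reverse:
  assumes H: "ordered_graph H" "reverses f (verts H)" and H': "ordered_graph H'" "reverses f' (verts H')"
    and F: "F \<in> ramsey_graphs H H'" "reverses g (verts F)"
  shows "relabel g F \<in> ramsey_graphs (relabel f H) (relabel f' H')"
proof -
  have oF: "ordered_graph F"
    and col: "\<And>c. embeds H (colour_class F c Red) \<or> embeds H' (colour_class F c Blue)"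
    using F(1) ramsey_graphs_iff[OF H(1) H'(1)] by blast+
  have "embeds (relabel f H) (colour_class (relabel g F) c Red) \<or>
      embeds (relabel f' H') (colour_class (relabel g F) c Blue)" for c
    using col[of "\<lambda>e. c (g ` e)"] embeds_reverse[OF H oF F(2)] embeds_reverse[OF H' oF F(2)] by blast
  moreover have "ordered_graph (relabel g F)"
    by (rule ordered_graph_relabel[OF oF reverses_inj[OF F(2)]])
  ultimately show ?thesis
    using ramsey_graphs_iff[OF ordered_graph_relabel[OF H(1) reverses_inj[OF H(2)]]
      ordered_graph_relabel[OF H'(1) reverses_inj[OF H'(2)]]] by blast
qed

lemma card_spanned_relabel:
  assumes G: "ordered_graph G" "inj_on f (verts G)" and W: "W \<subseteq> verts G"
  shows "card (spanned (relabel f G) (f ` W)) \<le> card (spanned G W)" "card (f ` W) = card W"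
proof -
  have "spanned (relabel f G) (f ` W) \<subseteq> (`) f ` spanned G W"
  proof
    fix e assume e: "e \<in> spanned (relabel f G) (f ` W)"
    then have "e \<in> (`) f ` edges G" "e \<subseteq> f ` W" by (simp_all add: spanned_def)
    then obtain d where d: "d \<in> edges G" "e = f ` d" "f ` d \<subseteq> f ` W" by blast
    have "d \<subseteq> verts G" using d(1) edges_subset_Pow[OF G(1)] by blast
    have "d \<subseteq> W"
    proof
      fix x assume "x \<in> d"
      moreover then have "f x \<in> f ` W" using d(3) by blast
      ultimately show "x \<in> W" using inj_on_image_mem_iff[OF G(2) _ W] \<open>d \<subseteq> verts G\<close> by blast
    qed
    then have "d \<in> spanned G W" using d(1) by (simp add: spanned_def)
    then show "e \<in> (`) f ` spanned G W" unfolding d(2) by (rule imageI)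
  qed
  then show "card (spanned (relabel f G) (f ` W)) \<le> card (spanned G W)"
    by (rule surj_card_le[OF finite_spanned[OF G(1)]])
  show "card (f ` W) = card W" using G(2) W by (intro card_image inj_on_subset[OF G(2)])
qed

lemma sparse_relabel:
  assumes G: "ordered_graph G" "inj_on f (verts G)" "sparse G"
  shows "sparse (relabel f G)"
  unfolding sparse_def
proof (intro allI impI)
  fix U assume "U \<subseteq> verts (relabel f G)"
  then obtain W where W: "W \<subseteq> verts G" "U = f ` W" by (auto simp: subset_image_iff)
  then have "card (spanned G W) \<le> card W" using G(3) unfolding sparse_def by blast
  then show "card (spanned (relabel f G) U) \<le> card U"
    using card_spanned_relabel[OF G(1,2) W(1)] W(2) by simp
qed

lemma strictly_sparse_relabel:
  assumes G: "ordered_graph G" "inj_on f (verts G)" "strictly_sparse G"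
  shows "strictly_sparse (relabel f G)"
  unfolding strictly_sparse_def
proof (intro allI impI)
  fix U assume "U \<subseteq> verts (relabel f G)" "U \<noteq> {}"
  then obtain W where W: "W \<subseteq> verts G" "U = f ` W" "W \<noteq> {}" by (auto simp: subset_image_iff)
  then have "card (spanned G W) < card W" using G(3) unfolding strictly_sparse_def by blast
  then show "card (spanned (relabel f G) U) < card U"
    using card_spanned_relabel[OF G(1,2) W(1)] W(2) by simp
qed

lemma connected_relabel:
  assumes "connected_graph G"
  shows "connected_graph (relabel f G)"
  unfolding connected_graph_def
proof (intro conjI ballI)
  show "verts (relabel f G) \<noteq> {}" using assms by (simp add: connected_graph_def)
  fix x y assume "x \<in> verts (relabel f G)" "y \<in> verts (relabel f G)"
  then obtain u v where uv: "u \<in> verts G" "x = f u" "v \<in> verts G" "y = f v" by auto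
  have "(u, v) \<in> {(x, y). {x, y} \<in> edges G}\<^sup>*" using assms uv by (simp add: connected_graph_def)
  then have "(f u, f v) \<in> {(x, y). {x, y} \<in> edges (relabel f G)}\<^sup>*"
  proof induction
    case (step a b)
    then have "f ` {a, b} \<in> (`) f ` edges G" by blast
    then have "(f a, f b) \<in> {(x, y). {x, y} \<in> edges (relabel f G)}" by simp
    then show ?case using step.IH by (rule rtrancl_into_rtrancl[rotated])
  qed simp
  then show "(x, y) \<in> {(x, y). {x, y} \<in> edges (relabel f G)}\<^sup>*" using uv by simp
qed

lemma has_left_reverse:
  assumes G: "ordered_graph G" "reverses f (verts G)" and "has_left (relabel f G)"
  shows "has_right G"
proof -
  obtain a b c where h: "b < a" "c < a" "b \<noteq> c" "{a, b} \<in> edges (relabel f G)" "{a, c} \<in> edges (relabel f G)"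
    using assms(3) unfolding has_left_def by blast
  note inj = reverses_inj[OF G(2)]
  have "a \<in> verts (relabel f G)" "b \<in> verts (relabel f G)" "c \<in> verts (relabel f G)"
    using ordered_graphD[OF ordered_graph_relabel[OF G(1) inj]] h by auto
  then obtain x y z where xyz: "a = f x" "b = f y" "c = f z" "x \<in> verts G" "y \<in> verts G" "z \<in> verts G"
    by auto
  have "x < y" "x < z" using h(1,2) xyz reverses_less_iff[OF G(2)] by auto
  moreover have "{x, y} \<in> edges G" "{x, z} \<in> edges G"
    using h(4,5) xyz relabel_edge_iff[OF G(1) inj] by auto
  moreover have "y \<noteq> z" using h(3) xyz by auto
  ultimately show ?thesis unfolding has_right_def by blast
qed

lemma monotone_P3_reverse:
  assumes "monotone_P3 G" "reverses f (verts G)"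
  shows "monotone_P3 (relabel f G)"
proof -
  obtain a b c where h: "a < b" "b < c" and G: "G = \<lparr>verts = {a, b, c}, edges = {{a, b}, {b, c}}\<rparr>"
    using assms(1) unfolding monotone_P3_def by blast
  have "f b < f a" "f c < f b" using assms(2) h unfolding reverses_def G by auto
  moreover have "relabel f G = \<lparr>verts = {f c, f b, f a}, edges = {{f c, f b}, {f b, f a}}\<rparr>"
    unfolding relabel_def G by (auto simp: insert_commute)
  ultimately show ?thesis unfolding monotone_P3_def by (intro exI[of _ "f c"] exI[of _ "f b"] exI[of _ "f a"]) simp
qed

section \<open>Pairs with a pseudoforest Ramsey graph\<close>

lemma ramsey_avoid:
  assumes F: "F \<in> ramsey_graphs H H'" and H: "ordered_graph H" "ordered_graph H'"
    and "\<not> embeds H (colour_class F c Red)" "\<not> embeds H' (colour_class F c Blue)"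
  shows False
  using assms ramsey_graphs_iff[OF H] by blast

lemma ramsey_ordered_graph: "F \<in> ramsey_graphs H H' \<Longrightarrow> ordered_graph F"
  by (simp add: ramsey_graphs_def)

lemma sparse_ramsey_restrictions:
  assumes H: "ordered_graph H" "connected_graph H" and H': "ordered_graph H'" "connected_graph H'"
    and F: "F \<in> ramsey_graphs H H'" "sparse F"
  shows "\<not> (has_right H \<and> has_left H')" "\<not> (has_mono H \<and> has_right H' \<and> has_left H')"
    "\<not> (has_mono H \<and> has_fork H')" "\<not> (has_mono H \<and> has_hook H')" "\<not> (has_mono H \<and> has_mono4 H')"
proof -
  note oF = ramsey_ordered_graph[OF F(1)]
  note avoid = ramsey_avoid[OF F(1) H(1) H'(1)]
  show "\<not> (has_right H \<and> has_left H')"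
  proof
    assume h: "has_right H \<and> has_left H'"
    show False
    proof (rule right_left_avoidable[OF oF F(2)])
      fix c assume c: "\<not> has_right (colour_class F c Red)" "\<not> has_left (colour_class F c Blue)"
      show False by (rule avoid[of c]) (use h c has_right_embeds H(1) has_left_embeds H'(1) in blast)+
    qed
  qed
  show "\<not> (has_mono H \<and> has_right H' \<and> has_left H')"
  proof
    assume h: "has_mono H \<and> has_right H' \<and> has_left H'"
    then have rl: "has_right H'" "has_left H'" by simp_all
    show False
    proof (rule mono_zigzag_avoidable[OF oF F(2) H' rl])
      fix c assume c: "\<not> has_mono (colour_class F c Red)" "\<not> embeds H' (colour_class F c Blue)"
      show False by (rule avoid[of c]) (use h c has_mono_embeds H(1) in blast)+
    qed
  qed
  show "\<not> (has_mono H \<and> has_fork H')"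
  proof
    assume h: "has_mono H \<and> has_fork H'"
    show False
    proof (rule mono_fork_hook_avoidable[OF oF F(2)])
      fix c assume c: "\<not> has_mono (colour_class F c Red)" "\<not> has_fork (colour_class F c Blue)"
      show False by (rule avoid[of c]) (use h c has_mono_embeds H(1) has_fork_embeds H'(1) in blast)+
    qed
  qed
  show "\<not> (has_mono H \<and> has_hook H')"
  proof
    assume h: "has_mono H \<and> has_hook H'"
    show False
    proof (rule mono_fork_hook_avoidable[OF oF F(2)])
      fix c assume c: "\<not> has_mono (colour_class F c Red)" "\<not> has_hook (colour_class F c Blue)"
      show False by (rule avoid[of c]) (use h c has_mono_embeds H(1) has_hook_embeds H'(1) in blast)+
    qed
  qed
  show "\<not> (has_mono H \<and> has_mono4 H')"
  proof
    assume h: "has_mono H \<and> has_mono4 H'"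
    show False
    proof (rule mono_mono4_avoidable[OF oF F(2)])
      fix c assume c: "\<not> has_mono (colour_class F c Red)" "\<not> has_mono4 (colour_class F c Blue)"
      show False by (rule avoid[of c]) (use h c has_mono_embeds H(1) has_mono4_embeds H'(1) in blast)+
    qed
  qed
qed

lemma star_no_left_strictly_sparse_ramsey:
  assumes H: "ordered_graph H" "connected_graph H" "edges H \<noteq> {}" "\<not> has_left H" "\<not> has_mono H"
    and H': "ordered_graph H'" "\<not> has_left H'"
  shows "\<exists>F\<in>ramsey_graphs H H'. strictly_sparse F"
proof -
  obtain z where z: "z \<in> verts H" "\<And>v. v \<in> verts H \<Longrightarrow> z \<le> v"
    "\<And>u v. {u, v} \<in> edges H \<Longrightarrow> u < v \<Longrightarrow> u = z"
    using star_center[OF H] by blast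
  let ?T = "digit_tree (card (verts H)) (card (verts H'))"
  have "?T \<in> ramsey_graphs H H'" by (rule star_tree_ramsey[OF H(1) z H'])
  moreover have "1 \<le> card (verts H)" using z(1) finite_verts[OF H(1)] by (simp add: Suc_le_eq card_gt_0_iff) blast
  then have "strictly_sparse ?T"
    using strictly_sparse_if_no_left[OF ordered_digit_tree] digit_tree_no_left by blast
  ultimately show ?thesis by blast
qed

text \<open>A graph without a monotone path would be a star and admit a Ramsey forest, against
  \<open>none\<close>. So both graphs contain monotone paths, and the colourings, applied with the
  roles of the two graphs in either order, exclude anything larger.\<close>

lemma no_left_both_monotone_P3:
  assumes H: "ordered_graph H" "connected_graph H" "edges H \<noteq> {}" "\<not> has_left H"
    and H': "ordered_graph H'" "connected_graph H'" "edges H' \<noteq> {}" "\<not> has_left H'"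
    and F: "F \<in> ramsey_graphs H H'" "sparse F"
    and none: "\<And>T. T \<in> ramsey_graphs H H' \<Longrightarrow> \<not> strictly_sparse T"
  shows "monotone_P3 H \<and> monotone_P3 H'"
proof -
  note swap = ramsey_graphs_swap[OF H(1) H'(1)]
  have m: "has_mono H"
    using star_no_left_strictly_sparse_ramsey[OF H(1-4) _ H'(1,4)] none by blast
  have m': "has_mono H'"
    using star_no_left_strictly_sparse_ramsey[OF H'(1-4) _ H(1,4)] none swap by blast
  have F': "F \<in> ramsey_graphs H' H" using F(1) swap by simp
  note r = sparse_ramsey_restrictions[OF H(1,2) H'(1,2) F]
    and r' = sparse_ramsey_restrictions[OF H'(1,2) H(1,2) F' F(2)]
  have "monotone_P3 H" using r'(3-5) m' by (intro monotone_P3_if[OF H(1,2) m H(4)]) simp_all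
  moreover have "monotone_P3 H'" using r(3-5) m by (intro monotone_P3_if[OF H'(1,2) m' H'(4)]) simp_all
  ultimately show ?thesis ..
qed

lemma no_right_both_monotone_P3:
  assumes H: "ordered_graph H" "connected_graph H" "edges H \<noteq> {}" "\<not> has_right H"
    and H': "ordered_graph H'" "connected_graph H'" "edges H' \<noteq> {}" "\<not> has_right H'"
    and F: "F \<in> ramsey_graphs H H'" "sparse F"
    and none: "\<And>T. T \<in> ramsey_graphs H H' \<Longrightarrow> \<not> strictly_sparse T"
  shows "monotone_P3 H \<and> monotone_P3 H'"
proof -
  obtain f :: "'a \<Rightarrow> nat" where f: "reverses f (verts H)"
    using reverses_exists[OF finite_verts[OF H(1)]] by blast
  obtain f' :: "'b \<Rightarrow> nat" where f': "reverses f' (verts H')"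
    using reverses_exists[OF finite_verts[OF H'(1)]] by blast
  obtain g :: "nat \<Rightarrow> nat" where g: "reverses g (verts F)"
    using reverses_exists[OF finite_verts[OF ramsey_ordered_graph[OF F(1)]]] by blast
  let ?H = "relabel f H" and ?H' = "relabel f' H'"
  note oH = ordered_graph_relabel[OF H(1) reverses_inj[OF f]]
  note oH' = ordered_graph_relabel[OF H'(1) reverses_inj[OF f']]
  \<comment> \<open>The hypothesis \<open>none\<close> speaks of \<open>H\<close> and
    \<open>H'\<close> themselves, so Ramsey graphs of the reversed pair must be carried back to
    exactly these graphs; the inverse maps do this.\<close>
  have undo: "relabel (inv_into (verts H) f) ?H = H" "relabel (inv_into (verts H') f') ?H' = H'"
    by (rule relabel_inv[OF H(1) reverses_inj[OF f]], rule relabel_inv[OF H'(1) reverses_inj[OF f']])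
  have inv: "reverses (inv_into (verts H) f) (verts ?H)" "reverses (inv_into (verts H') f') (verts ?H')"
    using reverses_inv[OF f] reverses_inv[OF f'] by simp_all
  have "monotone_P3 ?H \<and> monotone_P3 ?H'"
  proof (rule no_left_both_monotone_P3[OF oH connected_relabel[OF H(2)] _ _ oH' connected_relabel[OF H'(2)]])
    show "edges ?H \<noteq> {}" "edges ?H' \<noteq> {}" using H(3) H'(3) by simp_all
    show "\<not> has_left ?H" using has_left_reverse[OF H(1) f] H(4) by blast
    show "\<not> has_left ?H'" using has_left_reverse[OF H'(1) f'] H'(4) by blast
    show "relabel g F \<in> ramsey_graphs ?H ?H'"
      by (rule ramsey_graphs_reverse[OF H(1) f H'(1) f' F(1) g])
    show "sparse (relabel g F)"
      by (rule sparse_relabel[OF ramsey_ordered_graph[OF F(1)] reverses_inj[OF g] F(2)])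
    fix T assume T: "T \<in> ramsey_graphs ?H ?H'"
    note oT = ramsey_ordered_graph[OF T]
    obtain h :: "nat \<Rightarrow> nat" where h: "reverses h (verts T)"
      using reverses_exists[OF finite_verts[OF oT]] by blast
    have "relabel h T \<in> ramsey_graphs H H'"
      using ramsey_graphs_reverse[OF oH inv(1) oH' inv(2) T h] unfolding undo .
    then show "\<not> strictly_sparse T"
      using none strictly_sparse_relabel[OF oT reverses_inj[OF h]] by blast
  qed
  then have "monotone_P3 (relabel (inv_into (verts H) f) ?H)" "monotone_P3 (relabel (inv_into (verts H') f') ?H')"
    using monotone_P3_reverse[OF _ inv(1)] monotone_P3_reverse[OF _ inv(2)] by blast+
  then show ?thesis unfolding undo by blast
qed

lemma both_monotone_P3:
  assumes H: "ordered_graph H" "connected_graph H" "edges H \<noteq> {}" "\<not> is_K2 H"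
    and H': "ordered_graph H'" "connected_graph H'" "edges H' \<noteq> {}" "\<not> is_K2 H'"
    and F: "F \<in> ramsey_graphs H H'" "sparse F"
    and none: "\<And>T. T \<in> ramsey_graphs H H' \<Longrightarrow> \<not> strictly_sparse T"
  shows "monotone_P3 H \<and> monotone_P3 H'"
proof -
  have F': "F \<in> ramsey_graphs H' H" using F(1) ramsey_graphs_swap[OF H(1) H'(1)] by simp
  note r = sparse_ramsey_restrictions(1,2)[OF H(1,2) H'(1,2) F]
    and r' = sparse_ramsey_restrictions(1,2)[OF H'(1,2) H(1,2) F' F(2)]
  have "has_right H \<or> has_left H \<or> has_mono H" "has_right H' \<or> has_left H' \<or> has_mono H'"
    using is_K2_or_three_path[OF H(1-3)] is_K2_or_three_path[OF H'(1-3)] H(4) H'(4) by blast+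
  \<comment> \<open>Suppose a left star and a right star both occur. They cannot be in different
    graphs, so one graph has both and the other has neither. The other then contains a monotone
    path, which \<open>r\<close> or \<open>r'\<close> excludes.\<close>
  then consider "\<not> has_left H" "\<not> has_left H'" | "\<not> has_right H" "\<not> has_right H'"
    using r r' by blast
  then show ?thesis
    using no_left_both_monotone_P3[OF H(1-3) _ H'(1-3) _ F none]
      no_right_both_monotone_P3[OF H(1-3) _ H'(1-3) _ F none] by cases blast+
qed

section \<open>One of the graphs is a single edge\<close>

lemma K2_verts_edges:
  assumes "is_K2 H" "ordered_graph H"
  obtains u v where "u < v" "verts H = {u, v}" "edges H = {{u, v}}"
proof -
  obtain u v where uv: "u \<noteq> v" "H = \<lparr>verts = {u, v}, edges = {{u, v}}\<rparr>"
    using assms(1) unfolding is_K2_def by blast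
  then show thesis using that[of u v] that[of v u] by (cases u v rule: linorder_cases) (auto simp: insert_commute)
qed

text \<open>Provides a host on the naturals. Embeddings in both directions suffice, since both
  sparsity conditions pass backwards along embeddings.\<close>

lemma embeds_relabel_rank:
  assumes H: "ordered_graph H"
  shows "embeds H (relabel (rank (verts H)) H)" "embeds (relabel (rank (verts H)) H) H"
proof -
  let ?r = "rank (verts H)"
  note fin = finite_verts[OF H]
  have inj: "inj_on ?r (verts H)" using rank_eq_iff[OF fin] by (intro inj_onI) blast
  show "embeds H (relabel ?r H)" unfolding embeds_def
  proof (intro exI[of _ ?r] conjI allI impI)
    show "strict_mono_on (verts H) ?r" using rank_less[OF fin] by (intro strict_mono_onI)
    fix u v assume "{u, v} \<in> edges H"
    then have "?r ` {u, v} \<in> (`) ?r ` edges H" by (rule imageI)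
    then show "{?r u, ?r v} \<in> edges (relabel ?r H)" by simp
  qed simp
  let ?s = "inv_into (verts H) ?r"
  have s: "?s (?r v) = v" if "v \<in> verts H" for v using inv_into_f_f[OF inj that] .
  show "embeds (relabel ?r H) H" unfolding embeds_def
  proof (intro exI[of _ ?s] conjI allI impI)
    show "strict_mono_on (verts (relabel ?r H)) ?s"
    proof (rule strict_mono_onI)
      fix x y assume "x \<in> verts (relabel ?r H)" "y \<in> verts (relabel ?r H)" and xy: "x < y"
      then obtain u v where "u \<in> verts H" "x = ?r u" "v \<in> verts H" "y = ?r v" by auto
      then show "?s x < ?s y" using xy s rank_less_iff[OF fin] by simp
    qed
    show "?s ` verts (relabel ?r H) \<subseteq> verts H" using s by auto
    fix x y assume xy: "{x, y} \<in> edges (relabel ?r H)"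
    then have "x \<in> ?r ` verts H" "y \<in> ?r ` verts H"
      using ordered_graphD[OF ordered_graph_relabel[OF H inj] xy] by simp_all
    then obtain u v where uv: "u \<in> verts H" "x = ?r u" "v \<in> verts H" "y = ?r v" by blast
    then have "{u, v} \<in> edges H" using xy relabel_edge_iff[OF H inj uv(1,3)] by simp
    then show "{?s x, ?s y} \<in> edges H" using uv s by simp
  qed
qed

text \<open>Colouring everything blue forces a copy of \<open>H'\<close> in the host. Conversely, in
  a copy of \<open>H'\<close> either some edge is red, or all are blue and form
  \<open>H'\<close>.\<close>

lemma K2_ramsey_graphs:
  assumes K: "is_K2 H" "ordered_graph H" and H': "ordered_graph H'"
  shows "F \<in> ramsey_graphs H H' \<Longrightarrow> embeds H' F"
    and "\<exists>F\<in>ramsey_graphs H H'. embeds F H'"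
proof -
  obtain u v where uv: "u < v" "verts H = {u, v}" "edges H = {{u, v}}"
    using K2_verts_edges[OF K] .
  show "embeds H' F" if F: "F \<in> ramsey_graphs H H'"
  proof -
    have "\<not> embeds H (colour_class F (\<lambda>_. Blue) Red)"
      unfolding embeds_def using uv by auto
    then have "embeds H' (colour_class F (\<lambda>_. Blue) Blue)"
      using F ramsey_graphs_iff[OF K(2) H'] by blast
    moreover have "colour_class F (\<lambda>_. Blue) Blue = F" by (simp add: colour_class_def)
    ultimately show ?thesis by simp
  qed
  let ?F = "relabel (rank (verts H')) H'"
  have inj: "inj_on (rank (verts H')) (verts H')"
    using rank_eq_iff[OF finite_verts[OF H']] by (intro inj_onI) blast
  have oF: "ordered_graph ?F" by (rule ordered_graph_relabel[OF H' inj])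
  have "embeds H (colour_class ?F c Red) \<or> embeds H' (colour_class ?F c Blue)" for c
  proof (cases "\<exists>e\<in>edges ?F. c e = Red")
    case True
    then obtain e where e: "e \<in> edges ?F" "c e = Red" by blast
    obtain x y where xy: "e = {x, y}" "x < y" "x \<in> verts ?F" "y \<in> verts ?F"
      using ordered_graph_edgeD[OF oF e(1)] by blast
    have "embeds H (colour_class ?F c Red)" unfolding embeds_def
    proof (intro exI[of _ "\<lambda>w. if w = u then x else y"] conjI allI impI)
      show "strict_mono_on (verts H) (\<lambda>w. if w = u then x else y)"
        using uv xy(2) by (intro strict_mono_onI) auto
      show "(\<lambda>w. if w = u then x else y) ` verts H \<subseteq> verts (colour_class ?F c Red)"
        using uv xy(3,4) by auto
      fix a b assume "{a, b} \<in> edges H"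
      then have "a = u \<and> b = v \<or> a = v \<and> b = u" using uv(3) by (simp add: doubleton_eq_iff)
      moreover have "{x, y} \<in> edges (colour_class ?F c Red)" using e xy(1) by simp
      moreover have "{y, x} = {x, y}" by (rule insert_commute)
      ultimately show "{if a = u then x else y, if b = u then x else y} \<in> edges (colour_class ?F c Red)"
        using uv(1) less_imp_neq[OF uv(1)] by (elim disjE conjE) simp_all
    qed
    then show ?thesis ..
  next
    case False
    then have "c e = Blue" if "e \<in> edges ?F" for e using that by (cases "c e") auto
    then have "colour_class ?F c Blue = ?F" unfolding colour_class_def by (cases ?F) auto
    then show ?thesis using embeds_relabel_rank(1)[OF H'] by simp
  qed
  then have "?F \<in> ramsey_graphs H H'" using oF ramsey_graphs_iff[OF K(2) H'] by blast
  then show "\<exists>F\<in>ramsey_graphs H H'. embeds F H'" using embeds_relabel_rank(2)[OF H'] by blast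
qed

section \<open>Two monotone paths on three vertices\<close>

text \<open>Without a monochromatic monotone path, the pendant edges force the two triangle edges at 1, and
  also those at 3, to have equal colours, whereas the two at 2 must differ.\<close>

definition tailed_triangle :: "nat ograph" where
  "tailed_triangle = \<lparr>verts = {0, 1, 2, 3, 4}, edges = {{0, 1}, {1, 2}, {1, 3}, {2, 3}, {3, 4}}\<rparr>"

lemma ordered_tailed_triangle: "ordered_graph tailed_triangle"
  unfolding ordered_graph_def tailed_triangle_def by simp

lemma sparse_tailed_triangle: "sparse tailed_triangle"
proof -
  \<comment> \<open>The triangle is oriented cyclically, and each pendant edge is owned by its
    leaf.\<close>
  define g :: "nat set \<Rightarrow> nat" where
    "g e = (if e = {1, 3} then 3 else if e = {2, 3} then 2 else if e = {3, 4} then 4 else Min e)" for e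
  have E: "edges tailed_triangle = {{0, 1}, {1, 2}, {1, 3}, {2, 3}, {3, 4}}"
    by (simp add: tailed_triangle_def)
  have g: "g {0, 1} = 0" "g {1, 2} = 1" "g {1, 3} = 3" "g {2, 3} = 2" "g {3, 4} = 4"
    by (simp_all add: g_def doubleton_eq_iff min_absorb1)
  show ?thesis
  proof (rule sparse_if_orientation)
    show "finite (verts tailed_triangle)" by (simp add: tailed_triangle_def)
    show "inj_on g (edges tailed_triangle)"
      unfolding E by (intro inj_onI; elim insertE emptyE; hypsubst; simp add: g[unfolded One_nat_def])
    show "g e \<in> e" if "e \<in> edges tailed_triangle" for e
      using that unfolding E by (elim insertE) (simp_all add: g[unfolded One_nat_def])
  qed
qed

lemma embeds_monotone_P3:
  assumes H: "monotone_P3 H" and F: "ordered_graph F"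
  shows "embeds H F \<longleftrightarrow> has_mono F"
proof -
  obtain a b c where h: "a < b" "b < c" and G: "H = \<lparr>verts = {a, b, c}, edges = {{a, b}, {b, c}}\<rparr>"
    using H unfolding monotone_P3_def by blast
  have oH: "ordered_graph H" unfolding G using h by (intro ordered_graphI) auto
  show ?thesis
  proof
    have "has_mono H" unfolding has_mono_def G using h
      by (intro exI[of _ a] exI[of _ b] exI[of _ c]) simp
    then show "embeds H F \<Longrightarrow> has_mono F" using has_mono_embeds oH by blast
    assume "has_mono F"
    then obtain x y z where xyz: "x < y" "y < z" "{x, y} \<in> edges F" "{y, z} \<in> edges F"
      unfolding has_mono_def by blast
    define p where "p w = (if w = a then x else if w = b then y else z)" for w
    have p: "p a = x" "p b = y" "p c = z" using h by (auto simp: p_def)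
    show "embeds H F" unfolding embeds_def
    proof (intro exI[of _ p] conjI allI impI)
      show "strict_mono_on (verts H) p"
      proof (rule strict_mono_onI)
        fix r s assume "r \<in> verts H" "s \<in> verts H" "r < s"
        then have "r = a \<and> s = b \<or> r = b \<and> s = c \<or> r = a \<and> s = c" unfolding G using h by auto
        then show "p r < p s" using p xyz by auto
      qed
      show "p ` verts H \<subseteq> verts F"
        using ordered_graphD[OF F xyz(3)] ordered_graphD[OF F xyz(4)] p by (simp add: G)
      fix u v assume "{u, v} \<in> edges H"
      then have "u = a \<and> v = b \<or> u = b \<and> v = a \<or> u = b \<and> v = c \<or> u = c \<and> v = b"
        by (simp add: G doubleton_eq_iff)
      then show "{p u, p v} \<in> edges F" using p xyz(3,4) by (elim disjE) (simp_all add: insert_commute)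
    qed
  qed
qed

lemma ordered_colour_class: "ordered_graph F \<Longrightarrow> ordered_graph (colour_class F c k)"
  unfolding ordered_graph_def by simp

lemma monotone_P3_ordered_graph: "monotone_P3 H \<Longrightarrow> ordered_graph H"
  unfolding monotone_P3_def by (force intro!: ordered_graphI)

lemma tailed_triangle_ramsey:
  assumes "monotone_P3 H" "monotone_P3 H'"
  shows "tailed_triangle \<in> ramsey_graphs H H'"
proof -
  let ?T = tailed_triangle
  have "has_mono (colour_class ?T c Red) \<or> has_mono (colour_class ?T c Blue)" for c
  proof (rule ccontr)
    assume no: "\<not> ?thesis"
    have ne: "c {x, y} \<noteq> c {y, z}" if "x < y" "y < z" "{x, y} \<in> edges ?T" "{y, z} \<in> edges ?T" for x y z
    proof
      assume "c {x, y} = c {y, z}"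
      then have "has_mono (colour_class ?T c (c {x, y}))" unfolding has_mono_def using that
        by (intro exI[of _ x] exI[of _ y] exI[of _ z]) simp
      then show False using no by (cases "c {x, y}") simp_all
    qed
    have E: "edges ?T = {{0, 1}, {1, 2}, {1, 3}, {2, 3}, {3, 4}}" by (simp add: tailed_triangle_def)
    have "c {0, 1} \<noteq> c {1, 2}" "c {0, 1} \<noteq> c {1, 3}" "c {1, 2} \<noteq> c {2, 3}" "c {1, 3} \<noteq> c {3, 4}"
      "c {2, 3} \<noteq> c {3, 4}"
      by (rule ne; simp add: E)+
    then show False
      by (cases "c {0, 1}"; cases "c {1, 2}"; cases "c {1, 3}"; cases "c {2, 3}"; cases "c {3, 4}") simp_all
  qed
  then have "embeds H (colour_class ?T c Red) \<or> embeds H' (colour_class ?T c Blue)" for c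
    using embeds_monotone_P3[OF assms(1)] embeds_monotone_P3[OF assms(2)]
      ordered_colour_class[OF ordered_tailed_triangle] by blast
  then show ?thesis
    using ramsey_graphs_iff[OF assms[THEN monotone_P3_ordered_graph]] ordered_tailed_triangle by blast
qed

lemma monotone_P3_ramsey_not_strictly_sparse:
  assumes H: "monotone_P3 H" "monotone_P3 H'" and F: "F \<in> ramsey_graphs H H'"
  shows "\<not> strictly_sparse F"
proof
  assume s: "strictly_sparse F"
  note oF = ramsey_ordered_graph[OF F]
  show False
  proof (rule mono_mono_avoidable[OF oF s])
    fix c assume "\<not> has_mono (colour_class F c Red)" "\<not> has_mono (colour_class F c Blue)"
    then show False
      using ramsey_avoid[OF F H[THEN monotone_P3_ordered_graph]] ordered_colour_class[OF oF]
        embeds_monotone_P3[OF H(1)] embeds_monotone_P3[OF H(2)] by blast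
  qed
qed

section \<open>From densities to sparsity, and the final case distinction\<close>

text \<open>A strictly sparse Ramsey graph would push the infimum below 1. If there is none, a
  sparse Ramsey graph has density exactly 1 and attains the infimum.\<close>

lemma ramsey_density_pseudoforest_iff:
  "(ramsey_density H H' = 1 \<and> (\<exists>F\<in>ramsey_graphs H H'. pseudoforest F)) \<longleftrightarrow>
    (\<exists>F\<in>ramsey_graphs H H'. sparse F) \<and> (\<forall>F\<in>ramsey_graphs H H'. \<not> strictly_sparse F)"
proof -
  let ?D = "density ` ramsey_graphs H H'"
  have pf: "pseudoforest F \<longleftrightarrow> sparse F" if "F \<in> ramsey_graphs H H'" for F
    using density_le_1_iff[OF ramsey_ordered_graph[OF that]] ramsey_ordered_graph[OF that]
    by (simp add: pseudoforest_def)
  \<comment> \<open>On the reals \<open>Inf\<close> is a meaningful lower bound only for sets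
    bounded below.\<close>
  have "bdd_below ?D" using density_nonneg ramsey_ordered_graph by (intro bdd_belowI[of _ 0]) blast
  then have lower: "ramsey_density H H' \<le> density F" if "F \<in> ramsey_graphs H H'" for F
    unfolding ramsey_density_def using that by (intro cInf_lower) simp_all
  have strict: "density F < 1 \<longleftrightarrow> strictly_sparse F" if "F \<in> ramsey_graphs H H'" for F
    using density_less_1_iff[OF ramsey_ordered_graph[OF that]] .
  show ?thesis
  proof
    assume h: "ramsey_density H H' = 1 \<and> (\<exists>F\<in>ramsey_graphs H H'. pseudoforest F)"
    have "\<not> strictly_sparse F" if "F \<in> ramsey_graphs H H'" for F
      using lower[OF that] strict[OF that] h by linarith
    then show "(\<exists>F\<in>ramsey_graphs H H'. sparse F) \<and> (\<forall>F\<in>ramsey_graphs H H'. \<not> strictly_sparse F)"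
      using h pf by blast
  next
    assume h: "(\<exists>F\<in>ramsey_graphs H H'. sparse F) \<and> (\<forall>F\<in>ramsey_graphs H H'. \<not> strictly_sparse F)"
    then obtain F where F: "F \<in> ramsey_graphs H H'" "sparse F" by blast
    have ge: "1 \<le> density T" if "T \<in> ramsey_graphs H H'" for T
      using strict[OF that] h that by force
    have "density F = 1" using density_le_1_iff[OF ramsey_ordered_graph[OF F(1)]] F(2) ge[OF F(1)] by simp
    then have "ramsey_density H H' = 1"
      unfolding ramsey_density_def using F(1) ge by (intro cInf_eq_minimum) force+
    then show "ramsey_density H H' = 1 \<and> (\<exists>F\<in>ramsey_graphs H H'. pseudoforest F)"
      using F pf by blast
  qed
qed

text \<open>\<open>H'\<close> embeds into every Ramsey graph, and some Ramsey graph embeds into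
  \<open>H'\<close>. Hence a sparse or a strictly sparse Ramsey graph exists exactly when
  \<open>H'\<close> itself is such a graph.\<close>

lemma K2_case:
  assumes K: "is_K2 H" "ordered_graph H" and H': "ordered_graph H'"
  shows "(\<exists>F\<in>ramsey_graphs H H'. sparse F) \<and> (\<forall>F\<in>ramsey_graphs H H'. \<not> strictly_sparse F) \<longleftrightarrow>
    proper_pseudoforest H'"
proof -
  have pp: "proper_pseudoforest H' \<longleftrightarrow> sparse H' \<and> \<not> strictly_sparse H'"
    using density_le_1_iff[OF H'] cycle_not_strictly_sparse[OF H'] contains_cycle_if_not_strictly_sparse[OF H'] H'
    unfolding proper_pseudoforest_def pseudoforest_def by blast
  obtain F0 where F0: "F0 \<in> ramsey_graphs H H'" "embeds F0 H'"
    using K2_ramsey_graphs(2)[OF K H'] by blast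
  note ord0 = ramsey_ordered_graph[OF F0(1)]
  have emb: "ordered_graph F" "embeds H' F" if "F \<in> ramsey_graphs H H'" for F
    using ramsey_ordered_graph[OF that] K2_ramsey_graphs(1)[OF K H' that] .
  have "sparse H'" if "F \<in> ramsey_graphs H H'" "sparse F" for F
    by (rule sparse_embeds[OF emb(1)[OF that(1)] H' emb(2)[OF that(1)] that(2)])
  moreover have "sparse F0" if "sparse H'" by (rule sparse_embeds[OF H' ord0 F0(2) that])
  moreover have "strictly_sparse H'" if "F \<in> ramsey_graphs H H'" "strictly_sparse F" for F
    by (rule strictly_sparse_embeds[OF emb(1)[OF that(1)] H' emb(2)[OF that(1)] that(2)])
  moreover have "strictly_sparse F0" if "strictly_sparse H'"
    by (rule strictly_sparse_embeds[OF H' ord0 F0(2) that])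
  ultimately show ?thesis using pp F0(1) by blast
qed

lemma card_verts_K2:
  assumes "is_K2 G"
  shows "card (verts G) = 2" "finite (verts G)"
proof -
  obtain u v where "u \<noteq> v" "G = \<lparr>verts = {u, v}, edges = {{u, v}}\<rparr>"
    using assms unfolding is_K2_def by blast
  then show "card (verts G) = 2" "finite (verts G)" by simp_all
qed

lemma monotone_P3_not_K2:
  assumes "monotone_P3 G"
  shows "\<not> is_K2 G"
proof
  assume K: "is_K2 G"
  obtain a b c where h: "a < b" "b < c" and G: "G = \<lparr>verts = {a, b, c}, edges = {{a, b}, {b, c}}\<rparr>"
    using assms unfolding monotone_P3_def by blast
  have "a < c" using h by (rule less_trans)
  then have "card (verts G) = 3" using h less_imp_neq[OF h(1)] less_imp_neq[OF h(2)] by (simp add: G)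
  then show False using card_verts_K2[OF K] by simp
qed

lemma K2_not_proper_pseudoforest:
  assumes "is_K2 G"
  shows "\<not> proper_pseudoforest G"
proof
  assume "proper_pseudoforest G"
  then obtain xs where xs: "3 \<le> length xs" "distinct xs" "set xs \<subseteq> verts G"
    unfolding proper_pseudoforest_def contains_cycle_def by blast
  have "card (set xs) \<le> card (verts G)" by (rule card_mono[OF card_verts_K2(2)[OF assms] xs(3)])
  then show False using xs(1,2) card_verts_K2(1)[OF assms] by (simp add: distinct_card)
qed

theorem theorem4:
  fixes H :: "'a::linorder ograph" and H' :: "'b::linorder ograph"
  assumes "ordered_graph H" and "connected_graph H" and "edges H \<noteq> {}"
    and "ordered_graph H'" and "connected_graph H'" and "edges H' \<noteq> {}"
  shows "(ramsey_density H H' = 1 \<and> (\<exists>F\<in>ramsey_graphs H H'. pseudoforest F)) \<longleftrightarrow>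
    ((is_K2 H \<and> connected_graph H' \<and> proper_pseudoforest H') \<or>
     (is_K2 H' \<and> connected_graph H \<and> proper_pseudoforest H) \<or>
     (monotone_P3 H \<and> monotone_P3 H'))"
proof -
  note H = assms(1-3) and H' = assms(4-6)
  show ?thesis
  proof (cases "is_K2 H")
    case True
    \<comment> \<open>The other two alternatives cannot hold: \<open>K_2\<close> has too few
      vertices to contain a cycle or to be a path on three vertices.\<close>
    then show ?thesis
      unfolding ramsey_density_pseudoforest_iff K2_case[OF True H(1) H'(1)]
      using K2_not_proper_pseudoforest[OF True] monotone_P3_not_K2[of H] H'(2) by blast
  next
    case False
    show ?thesis
    proof (cases "is_K2 H'")
      case True
      then show ?thesis
        unfolding ramsey_density_pseudoforest_iff
          K2_case[OF True H'(1) H(1), folded ramsey_graphs_swap[OF H(1) H'(1)]]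
        using False H(2) monotone_P3_not_K2[of H'] by blast
    next
      case noK2: False
      have "monotone_P3 H \<and> monotone_P3 H'"
        if "\<exists>F\<in>ramsey_graphs H H'. sparse F" "\<forall>F\<in>ramsey_graphs H H'. \<not> strictly_sparse F"
        using both_monotone_P3[OF H False H' noK2] that by blast
      moreover have "(\<exists>F\<in>ramsey_graphs H H'. sparse F) \<and> (\<forall>F\<in>ramsey_graphs H H'. \<not> strictly_sparse F)"
        if "monotone_P3 H" "monotone_P3 H'"
        using tailed_triangle_ramsey[OF that] sparse_tailed_triangle
          monotone_P3_ramsey_not_strictly_sparse[OF that] by blast
      ultimately show ?thesis
        unfolding ramsey_density_pseudoforest_iff using False noK2 by blast
    qed
  qed
qed

end
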